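(* For a $C^*$-algebra $\mathcal{A}$, the following four statements are equivalent. (1) $\mathcal{A}$ is compact. (2) For any $c \in \mathcal{A}_+$, the order interval $[0,c]$ is (norm) compact. (3) For any $c \in \mathcal{A}_+$, the order interval $[0,c]$ is weakly compact. (4) For any relatively compact $M \subset \mathcal{A}_+$, the positive solid $\mathbf{PSol}(M)$ is relatively compact.
   Context: An element $a$ of a Banach algebra $\mathcal{A}$ is multiplication compact if the map $\mathcal{A}\to\mathcal{A}$, $b\mapsto aba$, is compact; the algebra $\mathcal{A}$ is called compact if all its elements are multiplication compact. $\mathcal{A}_+$ is the positive cone of $\mathcal{A}$. For $c\in\mathcal{A}_+$, $[0,c]=\{y\in\mathcal{A}_+ : y\le c\}$. For $M\subset\mathcal{A}_+$, $\mathbf{PSol}(M)=\{x\in\mathcal{A}_+ : 0\le x\le y \text{ for some } y\in M\}$. *)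

theory Defs
  imports "HOL-Analysis.Analysis"
begin

text \<open>
  A C*-algebra, not necessarily unital. The real scalar multiplication inherited from
  \<^class>\<open>real_normed_algebra\<close> is the restriction of the complex one.
\<close>

class cstar_algebra = real_normed_algebra + banach +
  fixes scaleC :: "complex \<Rightarrow> 'a \<Rightarrow> 'a" (infixr "*\<^sub>C" 75)
    and star :: "'a \<Rightarrow> 'a"
  assumes scaleC_add_right: "z *\<^sub>C (x + y) = z *\<^sub>C x + z *\<^sub>C y"
    and scaleC_add_left: "(z + w) *\<^sub>C x = z *\<^sub>C x + w *\<^sub>C x"
    and scaleC_scaleC: "z *\<^sub>C w *\<^sub>C x = (z * w) *\<^sub>C x"
    and scaleR_scaleC: "r *\<^sub>R x = complex_of_real r *\<^sub>C x"
    and norm_scaleC: "norm (z *\<^sub>C x) = cmod z * norm x"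
    and mult_scaleC_left: "(z *\<^sub>C x) * y = z *\<^sub>C (x * y)"
    and mult_scaleC_right: "x * (z *\<^sub>C y) = z *\<^sub>C (x * y)"
    and star_add: "star (x + y) = star x + star y"
    and star_scaleC: "star (z *\<^sub>C x) = cnj z *\<^sub>C star x"
    and star_mult: "star (x * y) = star y * star x"
    and star_star: "star (star x) = x"
    and cstar_identity: "norm (star x * x) = (norm x)\<^sup>2"

instantiation complex :: cstar_algebra
begin

definition scaleC_complex :: "complex \<Rightarrow> complex \<Rightarrow> complex"
  where "scaleC_complex z x = z * x"

definition star_complex :: "complex \<Rightarrow> complex"
  where "star_complex x = cnj x"

instance
  by standard
    (simp_all add: scaleC_complex_def star_complex_def algebra_simps norm_mult
      power2_eq_square scaleR_conv_of_real)

end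

text \<open>Multiplication of the unitization, where \<open>(a, \<alpha>)\<close> stands for \<open>a + \<alpha>1\<close>.\<close>

definition unitization_mult ::
    "'a::cstar_algebra \<times> complex \<Rightarrow> 'a \<times> complex \<Rightarrow> 'a \<times> complex"
  where "unitization_mult u v =
    (fst u * fst v + snd v *\<^sub>C fst u + snd u *\<^sub>C fst v, snd u * snd v)"

text \<open>
  The set of \<open>z\<close> such that \<open>a - z1\<close> has no two-sided inverse in the unitization. If the
  algebra already has a unit, this is the usual spectrum with 0 adjoined, which makes no
  difference for positivity.
\<close>

definition spectrum :: "'a::cstar_algebra \<Rightarrow> complex set"
  where "spectrum a = {z. \<not> (\<exists>u. unitization_mult (a, - z) u = (0, 1) \<and>
                                unitization_mult u (a, - z) = (0, 1))}"

definition positive_cone :: "'a::cstar_algebra set"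
  where "positive_cone =
    {a. star a = a \<and> spectrum a \<subseteq> complex_of_real ` {0..}}"

definition cstar_le :: "'a::cstar_algebra \<Rightarrow> 'a \<Rightarrow> bool" (infix "\<preceq>" 50)
  where "x \<preceq> y \<longleftrightarrow> y - x \<in> positive_cone"

definition order_interval_from_0 :: "'a::cstar_algebra \<Rightarrow> 'a set"
  where "order_interval_from_0 c = {y \<in> positive_cone. y \<preceq> c}"

definition PSol :: "'a::cstar_algebra set \<Rightarrow> 'a set"
  where "PSol M = {x \<in> positive_cone. \<exists>y\<in>M. 0 \<preceq> x \<and> x \<preceq> y}"

definition relatively_compact :: "'a::topological_space set \<Rightarrow> bool"
  where "relatively_compact S \<longleftrightarrow> compact (closure S)"

definition compact_operator :: "('a::real_normed_vector \<Rightarrow> 'b::real_normed_vector) \<Rightarrow> bool"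
  where "compact_operator f \<longleftrightarrow>
    bounded_linear f \<and> (\<forall>B. bounded B \<longrightarrow> relatively_compact (f ` B))"

definition multiplication_compact :: "'a::cstar_algebra \<Rightarrow> bool"
  where "multiplication_compact a \<longleftrightarrow> compact_operator (\<lambda>b. a * b * a)"

definition compact_algebra :: "'a::cstar_algebra itself \<Rightarrow> bool"
  where "compact_algebra _ \<longleftrightarrow> (\<forall>a::'a. multiplication_compact a)"

definition dual_space :: "('a::cstar_algebra \<Rightarrow> complex) set"
  where "dual_space = {f. bounded_linear f \<and> (\<forall>z x. f (z *\<^sub>C x) = z * f x)}"

definition weak_topology :: "'a::cstar_algebra topology"
  where "weak_topology =
    topology_generated_by {f -` U | f U. f \<in> dual_space \<and> open U}"

end

theory Submission
  imports Defs
begin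

text \<open>
  The implications are (1) to (4) to (2) to (3) to (1).

  Positivity is handled through squares of self-adjoint elements in the unitization: the
  binomial series gives square roots of \<open>1 - w\<close>, hence \<open>x\<close> with \<open>norm x \<le> t\<close> is positive iff
  \<open>norm (t - x) \<le> t\<close>; this makes the positive cone a closed convex cone without Gelfand theory.

  (1) to (4): for \<open>c \<ge> 0\<close> the element \<open>e = c (c + \<delta>)\<^sup>-\<^sup>1\<close> lies in the algebra and
  \<open>(1 - e) c (1 - e)\<close> is small. Hence \<open>x\<close> is uniformly close to \<open>e x e\<close> for all \<open>0 \<le> x \<le> y\<close>
  with \<open>y\<close> near one of the summands of \<open>c\<close>, and these \<open>e x e\<close> form a relatively compact set.

  (3) to (1): weak cluster points of \<open>u (u + 1/n)\<^sup>-\<^sup>1\<close>, where \<open>u\<close> is the positive part of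
  \<open>c - \<delta>\<close>, are projections \<open>q\<close> with \<open>c - c q\<close> small. By weak compactness a decreasing sequence of
  projections becomes stationary, so every projection is a finite sum of minimal ones, and
  \<open>b \<mapsto> p b q\<close> has rank at most one for minimal \<open>p\<close>, \<open>q\<close>. So \<open>b \<mapsto> a b a\<close> is a norm
  limit of finite rank maps.
\<close>

subsection \<open>Basic identities and the square root of \<open>1 - w\<close>\<close>

text \<open>The order intervals assumed compact lie in the algebra itself, whereas resolvents are
  bounded a priori only by the unit of the unitization. The cut at \<delta> repairs this: a positive
  e \<le> 1 that kills whatever the positive part u of c - \<delta> kills satisfies \<delta> e \<le>
  c, so all resolvents of u lie in the one interval from 0 to c/\<delta>. Multiplication is not
  jointly weakly continuous, so idempotence of a cluster point q of resolvents e_n cannot be read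
  off from e_n e_n. It comes from two other facts: by Hahn--Banach q lies in the norm-closed span of
  the e_n, so every p with p e_n = e_n for all n also fixes q; and q is itself such a p because q u
  = u. Where functional calculus is customary, square roots come instead with a clause that they
  commute with whatever commutes with the given element.\<close>

lemma star_zero [simp]: "star (0::'a::cstar_algebra) = 0"
  using star_add[of "0::'a" 0] by simp

lemma star_minus: "star (- x :: 'a::cstar_algebra) = - star x"
  using star_add[of x "- x"] by (simp add: eq_neg_iff_add_eq_0 add.commute)

lemma star_diff: "star (x - y :: 'a::cstar_algebra) = star x - star y"
  using star_add[of x "- y"] by (simp add: star_minus)

lemma star_scaleR: "star (r *\<^sub>R x :: 'a::cstar_algebra) = r *\<^sub>R star x"
  by (simp add: scaleR_scaleC star_scaleC)

lemma norm_star: "norm (star x :: 'a::cstar_algebra) = norm x"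
proof -
  have le: "norm y \<le> norm (star y)" for y :: 'a
  proof (cases "y = 0")
    case False
    have "norm y * norm y \<le> norm (star y) * norm y"
      using norm_mult_ineq[of "star y" y] by (simp add: cstar_identity power2_eq_square)
    with False show ?thesis by simp
  qed simp
  show ?thesis using le[of x] le[of "star x"] by (simp add: star_star)
qed

lemma bounded_linear_star: "bounded_linear (star :: 'a::cstar_algebra \<Rightarrow> 'a)"
  by (rule bounded_linear_intro[where K = 1]) (auto simp: star_add star_scaleR norm_star)

lemma norm_self_adjoint_square:
  "star x = x \<Longrightarrow> norm (x * x :: 'a::cstar_algebra) = (norm x)\<^sup>2"
  using cstar_identity[of x] by simp

lemma self_adjoint_square_eq_0:
  "star x = x \<Longrightarrow> x * x = 0 \<Longrightarrow> x = (0 :: 'a::cstar_algebra)"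
  using norm_self_adjoint_square[of x] by simp

lemma star_mult_self_eq_0: "star x * x = 0 \<Longrightarrow> x = (0 :: 'a::cstar_algebra)"
  using cstar_identity[of x] by simp

lemma scaleC_zero_left [simp]: "0 *\<^sub>C x = (0 :: 'a::cstar_algebra)"
  using norm_scaleC[of 0 x] by simp

lemma scaleC_zero_right [simp]: "z *\<^sub>C 0 = (0 :: 'a::cstar_algebra)"
  using norm_scaleC[of z "0::'a"] by simp

lemma scaleC_one [simp]: "1 *\<^sub>C x = (x :: 'a::cstar_algebra)"
  using scaleR_scaleC[of 1 x] by simp

lemma scaleC_minus_right: "z *\<^sub>C (- x) = - (z *\<^sub>C x :: 'a::cstar_algebra)"
  using scaleC_add_right[of z x "- x"] by (simp add: eq_neg_iff_add_eq_0 add.commute)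

lemma scaleC_minus_left: "(- z) *\<^sub>C x = - (z *\<^sub>C x :: 'a::cstar_algebra)"
  using scaleC_add_left[of z "- z" x] by (simp add: eq_neg_iff_add_eq_0 add.commute)

lemma scaleC_diff_right: "z *\<^sub>C (x - y) = z *\<^sub>C x - (z *\<^sub>C y :: 'a::cstar_algebra)"
  using scaleC_add_right[of z x "- y"] by (simp add: scaleC_minus_right)

lemma scaleC_scaleR: "z *\<^sub>C (r *\<^sub>R x) = r *\<^sub>R (z *\<^sub>C x :: 'a::cstar_algebra)"
  by (simp add: scaleR_scaleC scaleC_scaleC mult.commute)

text \<open>Free of units and spectra, so the same predicate serves the algebra and its unitization.
  Squares of self-adjoint elements are preferred to products \<open>star b * b\<close>, whose
  positivity is a theorem proved only after the order is understood.\<close>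

definition psd :: "'a::cstar_algebra \<Rightarrow> bool"
  where "psd x \<longleftrightarrow> (\<exists>y. star y = y \<and> x = y * y)"

lemma psd_self_adjoint: "psd x \<Longrightarrow> star x = x"
  by (auto simp: psd_def star_mult)

lemma psd_square: "star y = y \<Longrightarrow> psd (y * y)"
  by (auto simp: psd_def)

lemma psd_zero [simp]: "psd 0"
  using psd_square[of 0] by simp

lemma psd_scaleR:
  assumes "psd x" "0 \<le> r" shows "psd (r *\<^sub>R x)"
proof -
  obtain y where "star y = y" "x = y * y" using assms by (auto simp: psd_def)
  with \<open>0 \<le> r\<close> show ?thesis
    using psd_square[of "sqrt r *\<^sub>R y"] by (simp add: star_scaleR)
qed

section \<open>Unital algebras and invertible elements\<close>

class cstar_algebra_1 = cstar_algebra + real_normed_algebra_1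

lemma star_one [simp]: "star (1::'a::cstar_algebra_1) = 1"
  by (metis mult.left_neutral mult.right_neutral star_mult star_star)

lemma star_of_real [simp]: "star (of_real r :: 'a::cstar_algebra_1) = of_real r"
  by (simp add: of_real_def star_scaleR)

lemma of_real_commute: "x * of_real r = of_real r * (x :: 'a::real_algebra_1)"
  by (simp add: of_real_def)

definition has_inverse :: "'a::monoid_mult \<Rightarrow> bool"
  where "has_inverse x \<longleftrightarrow> (\<exists>y. x * y = 1 \<and> y * x = 1)"

lemma has_inverse_mult: "has_inverse x \<Longrightarrow> has_inverse y \<Longrightarrow> has_inverse (x * y)"
  unfolding has_inverse_def by (metis mult.assoc mult.left_neutral)

text \<open>\<open>z * y\<close> is a left and \<open>y * z\<close> a right inverse of
  \<open>x\<close>, so the two agree. It extracts one factor from invertible products such as a^2 +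
  t^2 = (a - it)(a + it).\<close>

lemma has_inverse_factor:
  assumes "has_inverse (x * y)" "x * y = y * x" shows "has_inverse x"
proof -
  obtain z where z: "x * y * z = 1" "z * (x * y) = 1" using assms(1) by (auto simp: has_inverse_def)
  have "(z * y) * x = 1" using z(2) assms(2) by (simp add: mult.assoc)
  moreover have "x * (y * z) = 1" using z(1) by (simp add: mult.assoc)
  ultimately show ?thesis unfolding has_inverse_def
    by (metis mult.assoc mult.left_neutral mult.right_neutral)
qed

lemma has_inverse_scaleR:
  "r \<noteq> 0 \<Longrightarrow> has_inverse (x :: 'a::real_algebra_1) \<Longrightarrow> has_inverse (r *\<^sub>R x)"
  unfolding has_inverse_def
  by (erule exE, rule_tac x = "inverse r *\<^sub>R y" in exI) simp

lemma has_inverse_one_minus: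
  fixes x :: "'a::{real_normed_algebra_1,banach}"
  assumes "norm x < 1" shows "has_inverse (1 - x)"
proof -
  have s: "summable (\<lambda>n. x ^ n)" by (rule complete_algebra_summable_geometric[OF assms])
  let ?S = "\<Sum>n. x ^ n"
  have S: "?S = 1 + (\<Sum>n. x ^ Suc n)" using suminf_split_head[OF s] by simp
  have "(\<Sum>n. x ^ Suc n) = x * ?S" using suminf_mult[OF s, of x] by simp
  moreover have "(\<Sum>n. x ^ Suc n) = ?S * x"
    using suminf_mult2[OF s, of x] by (simp add: power_commutes)
  ultimately show ?thesis unfolding has_inverse_def
    by (intro exI[of _ ?S]) (use S in \<open>simp add: algebra_simps\<close>)
qed

lemma has_inverse_near_of_real:
  fixes x :: "'a::{real_normed_algebra_1,banach}"
  assumes "norm (of_real t - x) < t" shows "has_inverse x"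
proof -
  have t: "t > 0" using assms norm_ge_zero[of "of_real t - x"] by linarith
  have "norm (1 - (1/t) *\<^sub>R x) = norm ((1/t) *\<^sub>R (of_real t - x))"
    using t by (simp add: scaleR_diff_right of_real_def)
  also have "\<dots> < 1" using t assms by simp
  finally have "has_inverse (1 - (1 - (1/t) *\<^sub>R x))" by (rule has_inverse_one_minus)
  then have "has_inverse ((1/t) *\<^sub>R x)" by simp
  then have "has_inverse (t *\<^sub>R ((1/t) *\<^sub>R x))" using t by (intro has_inverse_scaleR[of t "(1/t) *\<^sub>R x"]) auto
  then show ?thesis using t by simp
qed

text \<open>The coefficients of the binomial series of \<open>sqrt (1 - w)\<close>.\<close>

definition sqrt_coeff :: "nat \<Rightarrow> real"
  where "sqrt_coeff n = (- 1) ^ n * ((1/2) gchoose n)"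

lemma sqrt_coeff_0 [simp]: "sqrt_coeff 0 = 1"
  by (simp add: sqrt_coeff_def)

text \<open>Dividing the series of sqrt (1 - w) by 1 - w turns coefficients into partial sums. These
  are therefore the coefficients of (1 - w)^(-1/2), which are visibly nonnegative.\<close>

lemma sum_sqrt_coeff: "(\<Sum>k\<le>n. sqrt_coeff k) \<ge> 0"
proof -
  have "(\<Sum>k\<le>n. sqrt_coeff k) = (- 1) ^ n * ((1/2 - 1) gchoose n)"
    using gbinomial_sum_lower_neg[of "1/2 :: real" n]
    by (simp add: sqrt_coeff_def mult.commute)
  also have "\<dots> = (\<Prod>i = 0..<n. 1/2 + real i) / fact n"
  proof -
    have "(\<Prod>i = 0..<n. (1/2 - 1) - real i) = (\<Prod>i = 0..<n. (- 1) * (1/2 + real i))"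
      by (intro prod.cong) auto
    also have "\<dots> = (- 1) ^ n * (\<Prod>i = 0..<n. 1/2 + real i)"
      by (simp only: prod.distrib) simp
    finally show ?thesis
      by (simp add: gbinomial_prod_rev flip: power_mult_distrib mult.assoc)
  qed
  also have "\<dots> \<ge> 0" by (intro divide_nonneg_nonneg prod_nonneg) auto
  finally show ?thesis .
qed

lemma sqrt_coeff_Suc_le_0: "sqrt_coeff (Suc n) \<le> 0"
proof -
  have "(\<Prod>i = 0..<Suc n. (1/2) - real i) = 1/2 * (\<Prod>i = 0..<n. (- 1) * (1/2 + real i))"
    by (subst prod.atLeast0_lessThan_Suc_shift) (auto intro!: prod.cong)
  also have "\<dots> = 1/2 * ((- 1) ^ n * (\<Prod>i = 0..<n. 1/2 + real i))"
    by (simp only: prod.distrib) simp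
  finally have "sqrt_coeff (Suc n) = (- 1) ^ Suc n * (1/2 * ((- 1) ^ n * (\<Prod>i = 0..<n. 1/2 + real i)) / fact (Suc n))"
    unfolding sqrt_coeff_def gbinomial_prod_rev by (rule arg_cong)
  also have "\<dots> = - (1/2) * (\<Prod>i = 0..<n. 1/2 + real i) / fact (Suc n)"
    by (simp flip: power_mult_distrib mult.assoc)
  finally have "sqrt_coeff (Suc n) = - (1/2) * (\<Prod>i = 0..<n. 1/2 + real i) / fact (Suc n)" .
  moreover have "(\<Prod>i = 0..<n. 1/2 + real i) \<ge> 0" by (intro prod_nonneg) auto
  ultimately show ?thesis by (simp add: divide_nonneg_nonneg)
qed

text \<open>All coefficients but the first are nonpositive, so their absolute values add up to 1
  minus a nonnegative partial sum. This gives absolute convergence up to norm w = 1.\<close>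

lemma sum_abs_sqrt_coeff: "(\<Sum>k<n. \<bar>sqrt_coeff (Suc k)\<bar>) \<le> 1"
proof -
  have "(\<Sum>k<n. \<bar>sqrt_coeff (Suc k)\<bar>) = - (\<Sum>k<n. sqrt_coeff (Suc k))"
    unfolding sum_negf[symmetric] by (intro sum.cong) (auto simp: sqrt_coeff_Suc_le_0)
  also have "\<dots> = 1 - (\<Sum>k\<le>n. sqrt_coeff k)"
    by (simp add: sum.atMost_shift)
  finally show ?thesis using sum_sqrt_coeff[of n] by simp
qed

lemma summable_abs_sqrt_coeff: "summable (\<lambda>k. \<bar>sqrt_coeff (Suc k)\<bar>)"
  by (rule summableI_nonneg_bounded[where x = 1]) (auto simp: sum_abs_sqrt_coeff)

text \<open>By Vandermonde, convolving the binomial coefficients of 1/2 with themselves gives those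
  of 1.\<close>

lemma sqrt_coeff_convolution:
  "(\<Sum>k\<le>n. sqrt_coeff k * sqrt_coeff (n - k)) = (if n = 0 then 1 else if n = 1 then -1 else 0)"
proof -
  have "(\<Sum>k\<le>n. sqrt_coeff k * sqrt_coeff (n - k))
      = (- 1) ^ n * (\<Sum>k\<le>n. ((1/2) gchoose k) * ((1/2) gchoose (n - k)))"
    unfolding sum_distrib_left sqrt_coeff_def
  proof (intro sum.cong refl)
    fix k assume "k \<in> {..n}"
    then have "(- 1 :: real) ^ n = (- 1) ^ k * (- 1) ^ (n - k)" by (simp flip: power_add)
    then show "(- 1) ^ k * ((1/2 :: real) gchoose k) * ((- 1) ^ (n - k) * ((1/2) gchoose (n - k)))
      = (- 1) ^ n * (((1/2) gchoose k) * ((1/2) gchoose (n - k)))" by simp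
  qed
  also have "(\<Sum>k\<le>n. ((1/2 :: real) gchoose k) * ((1/2) gchoose (n - k))) = (1 gchoose n)"
    using gbinomial_Vandermonde[of "1/2 :: real" "1/2" n] by (simp add: atLeast0AtMost)
  also have "(1 gchoose n :: real) = of_nat (1 choose n)" by (metis binomial_gbinomial of_nat_1)
  finally show ?thesis by (cases n) (auto simp: binomial_eq_0)
qed

text \<open>The Cauchy product of the binomial series with itself collapses to 1 - w. The bound on 1
  - s will show that s is itself positive.\<close>

lemma sqrt_one_minus:
  fixes w :: "'a::cstar_algebra_1"
  assumes w: "star w = w" "norm w \<le> 1"
  shows "\<exists>s. star s = s \<and> s * s = 1 - w \<and> norm (1 - s) \<le> 1 \<and> (\<forall>v. v * w = w * v \<longrightarrow> v * s = s * v)"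
proof -
  have le: "norm (sqrt_coeff n *\<^sub>R w ^ n) \<le> \<bar>sqrt_coeff n\<bar>" for n
  proof -
    have "norm (w ^ n) \<le> norm w ^ n" by (rule norm_power_ineq)
    also have "\<dots> \<le> 1" using w by (simp add: power_le_one)
    finally show ?thesis by (simp add: mult_left_le)
  qed
  have sn': "summable (\<lambda>n. norm (sqrt_coeff (Suc n) *\<^sub>R w ^ Suc n))"
    by (rule summable_comparison_test'[OF summable_abs_sqrt_coeff, where N = 0]) (simp only: real_norm_def abs_norm_cancel le)
  then have sn: "summable (\<lambda>n. norm (sqrt_coeff n *\<^sub>R w ^ n))"
    by (subst (asm) summable_Suc_iff)
  then have sm: "summable (\<lambda>n. sqrt_coeff n *\<^sub>R w ^ n)" by (rule summable_norm_cancel)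
  define s where "s = (\<Sum>n. sqrt_coeff n *\<^sub>R w ^ n)"
  have "star (w ^ n) = w ^ n" for n
    by (induction n) (auto simp: star_mult w power_commutes)
  then have "star s = s"
    unfolding s_def by (simp add: bounded_linear.suminf[OF bounded_linear_star sm] star_scaleR)
  moreover have "s * s = 1 - w"
  proof -
    have "(\<lambda>n. \<Sum>k\<le>n. (sqrt_coeff k *\<^sub>R w ^ k) * (sqrt_coeff (n - k) *\<^sub>R w ^ (n - k))) sums (s * s)"
      unfolding s_def by (rule Cauchy_product_sums[OF sn sn])
    moreover have "(\<Sum>k\<le>n. (sqrt_coeff k *\<^sub>R w ^ k) * (sqrt_coeff (n - k) *\<^sub>R w ^ (n - k)))
        = (if n = 0 then 1 else if n = 1 then - w else 0)" for n
    proof -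
      have "(\<Sum>k\<le>n. (sqrt_coeff k *\<^sub>R w ^ k) * (sqrt_coeff (n - k) *\<^sub>R w ^ (n - k)))
        = (\<Sum>k\<le>n. (sqrt_coeff k * sqrt_coeff (n - k)) *\<^sub>R w ^ n)"
        by (intro sum.cong) (auto simp: mult.commute simp flip: power_add)
      then show ?thesis by (simp add: sqrt_coeff_convolution flip: scaleR_left.sum)
    qed
    ultimately have "(\<lambda>n. if n = 0 then 1 else if n = 1 then - w else 0) sums (s * s)" by simp
    moreover have "(\<lambda>n. if n = 0 then 1 else if n = 1 then - w else 0) sums (1 - w)"
      using sums_finite[of "{0,1}" "\<lambda>n::nat. if n = 0 then 1 else if n = 1 then - w else 0"] by auto
    ultimately show ?thesis by (rule sums_unique2)
  qed
  moreover have "norm (1 - s) \<le> 1"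
  proof -
    have "1 - s = - (\<Sum>n. sqrt_coeff (Suc n) *\<^sub>R w ^ Suc n)"
      using suminf_split_head[OF sm] by (simp add: s_def)
    then have "norm (1 - s) \<le> (\<Sum>n. norm (sqrt_coeff (Suc n) *\<^sub>R w ^ Suc n))"
      using summable_norm[OF sn'] by simp
    also have "\<dots> \<le> (\<Sum>k. \<bar>sqrt_coeff (Suc k)\<bar>)"
      by (rule suminf_le[OF le sn' summable_abs_sqrt_coeff])
    also have "\<dots> \<le> 1"
      by (rule suminf_le_const[OF summable_abs_sqrt_coeff sum_abs_sqrt_coeff])
    finally show ?thesis .
  qed
  moreover have "v * s = s * v" if "v * w = w * v" for v
  proof -
    have "v * w ^ n = w ^ n * v" for n
      by (rule power_commuting_commutes[symmetric]) (use that in simp)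
    then show ?thesis
      unfolding s_def by (simp add: suminf_mult[OF sm, symmetric] suminf_mult2[OF sm])
  qed
  ultimately show ?thesis by blast
qed

subsection \<open>Positive elements of a unital C*-algebra\<close>

text \<open>n = x + iz is normal with \<open>star n * n = x * x + z * z\<close>, and x is its real
  part, hence not larger in norm. This is monotonicity of the norm for commuting squares, obtained
  before any order is available.\<close>

lemma norm_self_adjoint_square_le_sum:
  fixes x z :: "'a::cstar_algebra"
  assumes x: "star x = x" and z: "star z = z" and comm: "x * z = z * x"
  shows "(norm x)\<^sup>2 \<le> norm (x * x + z * z)"
proof -
  define n where "n = x + \<i> *\<^sub>C z"
  have sn: "star n = x - \<i> *\<^sub>C z"
    by (simp add: n_def star_add star_scaleC x z scaleC_minus_left)
  have "star n * n = x * x + z * z"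
    by (simp add: sn) (simp add: n_def algebra_simps mult_scaleC_left mult_scaleC_right
      scaleC_scaleC scaleC_minus_left scaleC_diff_right scaleC_add_right comm)
  then have eq: "(norm n)\<^sup>2 = norm (x * x + z * z)" using cstar_identity[of n] by simp
  have "2 *\<^sub>R x = n + star n" by (simp add: sn) (simp add: n_def scaleR_2)
  then have "2 * norm x \<le> norm n + norm (star n)"
    by (metis norm_scaleR norm_triangle_ineq abs_numeral)
  then have "norm x \<le> norm n" by (simp add: norm_star)
  then show ?thesis by (metis eq norm_ge_zero power_mono)
qed

text \<open>After scaling to w = x/t, the square roots s of 1 - w and y' of w commute and their
  squares add up to 1. Hence norm (1 - w) = (norm s)^2 \<le> 1.\<close>

lemma psd_norm_of_real_minus:
  fixes x :: "'a::cstar_algebra_1"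
  assumes "psd x" "norm x \<le> t" shows "norm (of_real t - x) \<le> t"
proof (cases "t = 0")
  case True
  with assms show ?thesis by simp
next
  case False
  then have t: "t > 0" using assms(2) norm_ge_zero[of x] by linarith
  obtain y where y: "star y = y" "x = y * y" using assms(1) by (auto simp: psd_def)
  define w where "w = (1 / t) *\<^sub>R x"
  have "star w = w" by (simp add: w_def star_scaleR psd_self_adjoint assms)
  moreover have "norm w \<le> 1" using t assms by (simp add: w_def)
  ultimately obtain s where s: "star s = s" "s * s = 1 - w" "\<And>v. v * w = w * v \<Longrightarrow> v * s = s * v"
    using sqrt_one_minus by blast
  define y' where "y' = sqrt (1 / t) *\<^sub>R y"
  have y': "star y' = y'" "y' * y' = w" using t y by (auto simp: y'_def w_def star_scaleR)
  have "s * y' = y' * s" by (rule s(3)[symmetric]) (simp add: mult.assoc flip: y'(2))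
  then have "(norm s)\<^sup>2 \<le> norm (s * s + y' * y')"
    by (intro norm_self_adjoint_square_le_sum s y')
  also have "\<dots> = 1" by (simp add: s y')
  finally have "norm (1 - w) \<le> 1" using norm_self_adjoint_square[of s] by (simp add: s)
  moreover have "of_real t - x = t *\<^sub>R (1 - w)" using t by (simp add: w_def scaleR_diff_right of_real_def)
  ultimately show ?thesis using t by simp
qed

text \<open>The scalar r stays separate from s because norm (1 - s) \<le> 1 is what makes s positive
  in \<open>psd_sqrt\<close>; absorbing sqrt r would destroy that bound.\<close>

lemma psd_if_norm_of_real_minus_le_aux:
  fixes x :: "'a::cstar_algebra_1"
  assumes x: "star x = x" and n: "norm (of_real t - x) \<le> t"
  shows "\<exists>s r. star s = s \<and> 0 \<le> r \<and> norm (1 - s) \<le> 1 \<and> x = r *\<^sub>R (s * s) \<and>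
    (\<forall>v. v * x = x * v \<longrightarrow> v * s = s * v)"
proof (cases "t = 0")
  case True
  with n show ?thesis by (intro exI[of _ 1] exI[of _ 0]) auto
next
  case False
  then have t: "t > 0" using n norm_ge_zero[of "of_real t - x"] by linarith
  define w where "w = 1 - (1 / t) *\<^sub>R x"
  have "star w = w" by (simp add: w_def star_diff star_scaleR x)
  moreover have "w = (1 / t) *\<^sub>R (of_real t - x)"
    using t by (simp add: w_def scaleR_diff_right of_real_def)
  then have "norm w \<le> 1" using t n by simp
  ultimately obtain s where s: "star s = s" "s * s = 1 - w" "norm (1 - s) \<le> 1"
    "\<And>v. v * w = w * v \<Longrightarrow> v * s = s * v"
    using sqrt_one_minus by blast
  have "x = t *\<^sub>R (s * s)" using t by (simp add: s w_def)
  moreover have "v * s = s * v" if "v * x = x * v" for v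
    by (rule s(4)) (simp add: w_def algebra_simps that)
  ultimately show ?thesis using s(1,3) less_imp_le[OF t] by blast
qed

lemma psd_if_norm_of_real_minus_le:
  fixes x :: "'a::cstar_algebra_1"
  assumes "star x = x" "norm (of_real t - x) \<le> t"
  shows "psd x"
  using psd_if_norm_of_real_minus_le_aux[OF assms] by (auto intro!: psd_scaleR psd_square)

lemma psd_sqrt:
  fixes x :: "'a::cstar_algebra_1"
  assumes x: "psd x"
  shows "\<exists>s. psd s \<and> s * s = x \<and> (\<forall>v. v * x = x * v \<longrightarrow> v * s = s * v)"
proof -
  have n: "norm (of_real (norm x) - x) \<le> norm x" by (rule psd_norm_of_real_minus[OF x]) simp
  obtain s r where s: "star s = s" "0 \<le> r" "norm (1 - s) \<le> 1" "x = r *\<^sub>R (s * s)"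
    "\<And>v. v * x = x * v \<Longrightarrow> v * s = s * v"
    using psd_if_norm_of_real_minus_le_aux[OF psd_self_adjoint[OF x] n] by blast
  have "psd s" using s(1,3) by (intro psd_if_norm_of_real_minus_le[of s 1]) auto
  show ?thesis
  proof (intro exI[of _ "sqrt r *\<^sub>R s"] conjI allI impI)
    show "psd (sqrt r *\<^sub>R s)" using \<open>psd s\<close> s(2) by (simp add: psd_scaleR)
    show "(sqrt r *\<^sub>R s) * (sqrt r *\<^sub>R s) = x" using s(2,4) by simp
    show "v * (sqrt r *\<^sub>R s) = (sqrt r *\<^sub>R s) * v" if "v * x = x * v" for v
      using s(5)[OF that] by simp
  qed
qed

text \<open>The balls norm (t - x) \<le> t add up under the triangle inequality, which also covers x
  and y that do not commute.\<close>

lemma psd_add_unital: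
  fixes x y :: "'a::cstar_algebra_1"
  assumes "psd x" "psd y" shows "psd (x + y)"
proof (rule psd_if_norm_of_real_minus_le)
  show "star (x + y) = x + y" using assms by (simp add: star_add psd_self_adjoint)
  have "of_real (norm x + norm y) - (x + y) = (of_real (norm x) - x) + (of_real (norm y) - y)"
    by (simp add: algebra_simps)
  also have "norm \<dots> \<le> norm x + norm y"
    by (intro norm_triangle_mono psd_norm_of_real_minus assms) auto
  finally show "norm (of_real (norm x + norm y) - (x + y)) \<le> norm x + norm y" .
qed

lemma psd_of_real: "0 \<le> r \<Longrightarrow> psd (of_real r :: 'a::cstar_algebra_1)"
  using psd_scaleR[OF psd_square[of "1::'a"]] by (simp add: of_real_def)

lemma closed_psd_unital: "closed {x :: 'a::cstar_algebra_1. psd x}"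
proof -
  have "{x :: 'a. psd x} = {x. star x = x} \<inter> {x. norm (of_real (norm x) - x) \<le> norm x}"
    by (auto intro: psd_self_adjoint psd_norm_of_real_minus psd_if_norm_of_real_minus_le)
  moreover have "closed {x :: 'a. star x = x}"
    by (intro closed_Collect_eq linear_continuous_on bounded_linear_star continuous_intros)
  moreover have "closed {x :: 'a. norm (of_real (norm x) - x) \<le> norm x}"
    by (intro closed_Collect_le continuous_intros)
  ultimately show ?thesis by (simp add: closed_Int)
qed

lemma psd_mult_commute:
  fixes x y :: "'a::cstar_algebra_1"
  assumes "psd x" "psd y" and comm: "x * y = y * x" shows "psd (x * y)"
proof -
  obtain s where s: "psd s" "s * s = x" "\<And>v. v * x = x * v \<Longrightarrow> v * s = s * v"
    using psd_sqrt[OF assms(1)] by blast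
  obtain r where r: "psd r" "r * r = y" "\<And>v. v * y = y * v \<Longrightarrow> v * r = r * v"
    using psd_sqrt[OF assms(2)] by blast
  have "y * s = s * y" by (rule s(3)) (simp add: comm)
  then have sr: "s * r = r * s" by (intro r(3)) simp
  have "x * y = (s * r) * (s * r)" by (metis s(2) r(2) sr mult.assoc)
  moreover have "star (s * r) = s * r"
    by (simp add: star_mult psd_self_adjoint s(1) r(1) sr)
  ultimately show ?thesis using psd_square[of "s * r"] by simp
qed

section \<open>Positivity and norm in terms of invertibility\<close>

lemma psd_has_inverse_add:
  fixes x :: "'a::cstar_algebra_1"
  assumes "psd x" "s > 0" shows "has_inverse (x + of_real s)"
proof (rule has_inverse_near_of_real)
  have "of_real (norm x + s) - (x + of_real s) = of_real (norm x) - x" by simp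
  then show "norm (of_real (norm x + s) - (x + of_real s)) < norm x + s"
    using psd_norm_of_real_minus[OF assms(1), of "norm x"] assms(2) by simp
qed

lemma psd_has_inverse_diff:
  fixes x :: "'a::cstar_algebra_1"
  assumes "psd (of_real t - x)" "s > t" shows "has_inverse (of_real s - x)"
  using psd_has_inverse_add[OF assms(1), of "s - t"] assms(2) by (simp add: algebra_simps)

text \<open>
  This replaces the spectral radius formula: \<open>norm x\<close> or \<open>- norm x\<close> lies in the spectrum of \<open>x\<close>.
  If \<open>g\<close> inverts \<open>1 - x * x\<close> and \<open>M = norm g\<close>, then \<open>M - g\<close> is positive, so that
  \<open>M - 1 = M x\<^sup>2 + z\<^sup>2\<close> with \<open>z\<close> commuting with \<open>x\<close>, and the norm of the right side is at least \<open>M\<close>.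
\<close>

lemma norm_square_minus_square_singular_aux:
  fixes x :: "'a::cstar_algebra_1"
  assumes x: "star x = x" "norm x = 1" shows "\<not> has_inverse (1 - x * x)"
proof
  assume "has_inverse (1 - x * x)"
  then obtain g where g: "(1 - x * x) * g = 1" "g * (1 - x * x) = 1" by (auto simp: has_inverse_def)
  have "star g * (1 - x * x) = 1" using arg_cong[OF g(1), of star] by (simp add: star_mult star_diff x)
  then have sg: "star g = g" by (metis g(1) mult.assoc mult.left_neutral mult.right_neutral)
  have comm: "v * g = g * v" if "v * x = x * v" for v
  proof -
    have "v * (1 - x * x) = (1 - x * x) * v"
      by (simp add: algebra_simps) (metis that mult.assoc)
    then show ?thesis by (metis g mult.assoc mult.left_neutral mult.right_neutral)
  qed
  have xx: "psd (1 - x * x)"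
    using psd_norm_of_real_minus[OF psd_square[OF x(1)], of 1] x
    by (intro psd_if_norm_of_real_minus_le[of _ 1]) (auto simp: star_diff star_mult norm_self_adjoint_square)
  define M where "M = norm g"
  \<comment> \<open>M \<ge> 1 serves the last step, where the norm of the scalar M - 1 must be M - 1
    itself.\<close>
  have "1 \<le> norm (1 - x * x) * norm g"
    using norm_mult_ineq[of "1 - x * x" g] by (simp add: g)
  moreover have n1: "norm (1 - x * x) \<le> 1"
    using psd_norm_of_real_minus[OF psd_square[OF x(1)], of 1] x by (simp add: norm_self_adjoint_square)
  ultimately have M: "M \<ge> 1" unfolding M_def
    by (metis mult_right_mono mult_1 norm_ge_zero order_trans)
  have g2: "psd ((g * g) * (1 - x * x))"
    by (rule psd_mult_commute[OF psd_square[OF sg] xx]) (metis g mult.assoc mult.left_neutral mult.right_neutral)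
  have "psd g" using g2 by (simp add: mult.assoc g)
  \<comment> \<open>The ball criterion for M - g with centre M asks only for norm g \<le> M.\<close>
  have Mg: "psd (of_real M - g)"
    by (rule psd_if_norm_of_real_minus_le[of _ M]) (auto simp: star_diff sg M_def)
  have Mgx: "psd ((of_real M - g) * (1 - x * x))"
    by (rule psd_mult_commute[OF Mg xx]) (simp only: left_diff_distrib[of "of_real M" g] right_diff_distrib[of _ "of_real M" g] g of_real_commute)
  have eq: "(of_real M - g) * (1 - x * x) = of_real (M - 1) - M *\<^sub>R (x * x)"
    by (subst left_diff_distrib, subst g(2)) (simp add: scaleR_conv_of_real algebra_simps)
  obtain z where z: "psd z" "z * z = of_real (M - 1) - M *\<^sub>R (x * x)"
    "\<And>v. v * (of_real (M - 1) - M *\<^sub>R (x * x)) = (of_real (M - 1) - M *\<^sub>R (x * x)) * v \<Longrightarrow> v * z = z * v"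
    using psd_sqrt[OF Mgx] unfolding eq by blast
  have xz: "x * z = z * x" by (rule z(3)) (simp add: algebra_simps of_real_def)
  have "(norm (sqrt M *\<^sub>R x))\<^sup>2 \<le> norm ((sqrt M *\<^sub>R x) * (sqrt M *\<^sub>R x) + z * z)"
    by (rule norm_self_adjoint_square_le_sum) (simp_all add: star_scaleR psd_self_adjoint x z(1) xz)
  also have "\<dots> = norm (of_real (M - 1) :: 'a)" using M by (simp add: z(2))
  also have "\<dots> = M - 1" using M by (simp only: norm_of_real)
  finally show False using M x by (simp add: power_mult_distrib)
qed

lemma norm_square_minus_square_singular:
  fixes x :: "'a::cstar_algebra_1"
  assumes x: "star x = x" "x \<noteq> 0" shows "\<not> has_inverse (of_real ((norm x)\<^sup>2) - x * x)"
proof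
  assume "has_inverse (of_real ((norm x)\<^sup>2) - x * x)"
  then have "has_inverse ((1 / (norm x)\<^sup>2) *\<^sub>R (of_real ((norm x)\<^sup>2) - x * x))"
    by (rule has_inverse_scaleR[rotated]) (use x(2) in simp)
  moreover have "(1 / (norm x)\<^sup>2) *\<^sub>R (of_real ((norm x)\<^sup>2) - x * x)
      = 1 - ((1 / norm x) *\<^sub>R x) * ((1 / norm x) *\<^sub>R x)"
    using x by (simp add: scaleR_diff_right of_real_def power2_eq_square)
  ultimately show False
    using norm_square_minus_square_singular_aux[of "(1 / norm x) *\<^sub>R x"] x by (auto simp: star_scaleR)
qed

lemma has_inverse_square_minus_square:
  fixes x :: "'a::cstar_algebra_1"
  assumes "has_inverse (of_real r - x)" "has_inverse (of_real r + x)"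
  shows "has_inverse (of_real (r\<^sup>2) - x * x)"
proof -
  have "(of_real r - x) * (of_real r + x) = of_real (r\<^sup>2) - x * x"
    by (simp only: of_real_def left_diff_distrib distrib_left power2_eq_square) simp
  then show ?thesis using has_inverse_mult[OF assms] by simp
qed

text \<open>With both factors invertible, (norm x)^2 - x^2 would be invertible too, which is
  impossible for nonzero x. Later contradictions all use the lower half of spectral theory in this
  form.\<close>

lemma self_adjoint_eq_0:
  fixes x :: "'a::cstar_algebra_1"
  assumes "star x = x" "has_inverse (of_real (norm x) - x)" "has_inverse (of_real (norm x) + x)"
  shows "x = 0"
  using norm_square_minus_square_singular[OF assms(1)] has_inverse_square_minus_square[OF assms(2,3)]
  by blast

text \<open>If x fails the ball criterion at t = norm x, then w = t - x has norm above t. Now norm w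
  - w is x plus a positive scalar, invertible by hypothesis, and norm w + w is invertible by a
  Neumann series, so w = 0, a contradiction.\<close>

lemma psd_if_has_inverse:
  fixes x :: "'a::cstar_algebra_1"
  assumes x: "star x = x" and inv: "\<And>s. s > 0 \<Longrightarrow> has_inverse (x + of_real s)"
  shows "psd x"
proof (rule ccontr)
  assume np: "\<not> psd x"
  define t where "t = norm x"
  define w where "w = of_real t - x"
  have "x \<noteq> 0" using np by auto
  then have t: "t > 0" by (simp add: t_def)
  have sw: "star w = w" by (simp add: w_def star_diff x)
  have r: "norm w > t"
    using np psd_if_norm_of_real_minus_le[OF x, of t] by (force simp: w_def)
  have "has_inverse (of_real (norm w) - w)"
    using inv[of "norm w - t"] r by (simp add: w_def algebra_simps)
  moreover have "has_inverse (of_real (norm w) + w)"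
  proof (rule has_inverse_near_of_real[of "norm w + t"])
    have *: "of_real (norm w + t) - (of_real (norm w) + w) = x" by (simp add: w_def)
    show "norm (of_real (norm w + t) - (of_real (norm w) + w)) < norm w + t"
      unfolding * using r t unfolding t_def by linarith
  qed
  ultimately have "w = 0" by (rule self_adjoint_eq_0[OF sw])
  then show False using r t by simp
qed

lemma psd_antisym_unital:
  fixes x :: "'a::cstar_algebra_1"
  assumes "psd x" "psd (- x)" shows "x = 0"
proof (rule ccontr)
  assume "x \<noteq> 0"
  then have "norm x > 0" by simp
  moreover from this have "has_inverse (of_real (norm x) - x)" "has_inverse (of_real (norm x) + x)"
    using psd_has_inverse_add[OF assms(1)] psd_has_inverse_add[OF assms(2)]
    by (auto simp: algebra_simps)
  ultimately show False using self_adjoint_eq_0[OF psd_self_adjoint[OF assms(1)]] by simp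
qed

lemma psd_norm_le:
  fixes x :: "'a::cstar_algebra_1"
  assumes "psd x" "psd (of_real t - x)" "t \<ge> 0" shows "norm x \<le> t"
proof (rule ccontr)
  assume r: "\<not> norm x \<le> t"
  then have "norm x > 0" using assms(3) by linarith
  with r have "has_inverse (of_real (norm x) - x)" "has_inverse (of_real (norm x) + x)"
    using psd_has_inverse_add[OF assms(1), of "norm x"] psd_has_inverse_diff[OF assms(2), of "norm x"] assms(3)
    by (auto simp: algebra_simps)
  then show False using self_adjoint_eq_0[OF psd_self_adjoint[OF assms(1)]] r assms(3) by auto
qed

lemma psd_norm_minus: "star x = x \<Longrightarrow> psd (of_real (norm x) - x :: 'a::cstar_algebra_1)"
  by (rule psd_if_norm_of_real_minus_le[of _ "norm x"]) (auto simp: star_diff)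

lemma psd_norm_mono_unital:
  fixes x y :: "'a::cstar_algebra_1"
  assumes "psd x" "psd (y - x)" shows "norm x \<le> norm y"
proof (rule psd_norm_le[OF assms(1)])
  have "psd y" using psd_add_unital[OF assms] by simp
  then have "psd ((of_real (norm y) - y) + (y - x))"
    by (intro psd_add_unital psd_norm_minus assms psd_self_adjoint)
  then show "psd (of_real (norm y) - x)" by simp
qed simp

text \<open>With k the square root of h^2, the parts are (k + h)/2 and (k - h)/2. Their positivity
  follows from (u + s)(v + s) = s(k + s), valid because u v = 0: the right side is invertible, hence
  so is each factor.\<close>

lemma pos_neg_parts:
  fixes h :: "'a::cstar_algebra_1"
  assumes h: "star h = h"
  obtains u v where "psd u" "psd v" "h = u - v" "u * v = 0" "v * u = 0"
proof -
  obtain k where k: "psd k" "k * k = h * h" "\<And>v. v * (h * h) = (h * h) * v \<Longrightarrow> v * k = k * v"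
    using psd_sqrt[OF psd_square[OF h]] by blast
  have hk: "h * k = k * h" by (rule k(3)) (simp add: mult.assoc)
  define u v where "u = (1/2) *\<^sub>R (k + h)" and "v = (1/2) *\<^sub>R (k - h)"
  have uv: "u * v = 0" "v * u = 0" by (simp_all add: u_def v_def algebra_simps k(2) hk)
  have s: "star u = u" "star v = v"
    by (simp_all add: u_def v_def star_scaleR star_add star_diff h psd_self_adjoint k(1))
  have kuv: "k = u + v" by (simp add: u_def v_def flip: scaleR_add_right)
  have inv: "has_inverse (u + of_real s)" "has_inverse (v + of_real s)" if "s > 0" for s
  proof -
    have "has_inverse (s *\<^sub>R (k + of_real s))" using that by (intro has_inverse_scaleR psd_has_inverse_add k) auto
    moreover have "s *\<^sub>R (k + of_real s) = (u + of_real s) * (v + of_real s)"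
      "s *\<^sub>R (k + of_real s) = (v + of_real s) * (u + of_real s)"
      by (simp_all add: kuv algebra_simps uv of_real_def)
    ultimately show "has_inverse (u + of_real s)" "has_inverse (v + of_real s)"
      by (metis has_inverse_factor)+
  qed
  show ?thesis
  proof (rule that[OF psd_if_has_inverse psd_if_has_inverse])
    show "h = u - v" by (simp add: u_def v_def flip: scaleR_diff_right)
  qed (use s inv uv in auto)
qed

text \<open>The two products have the same spectrum away from 0: if g inverts
  \<open>of_real s - star w * w\<close>, then (1/s)(1 + w g \<open>star w\<close>) inverts
  \<open>of_real s - w * star w\<close>.\<close>

lemma psd_minus_mult_star:
  fixes w :: "'a::cstar_algebra_1"
  assumes "psd (- (star w * w))" shows "psd (- (w * star w))"
proof (rule psd_if_has_inverse)
  fix s :: real assume s: "s > 0"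
  obtain g where g: "(of_real s - star w * w) * g = 1" "g * (of_real s - star w * w) = 1"
    using psd_has_inverse_add[OF assms s] by (auto simp: has_inverse_def)
  have 1: "star w * w * g = s *\<^sub>R g - 1" using g(1) by (simp add: algebra_simps of_real_def)
  have 2: "g * (star w * w) = s *\<^sub>R g - 1" using g(2) by (simp add: algebra_simps of_real_def)
  have "w * (star w * (w * (g * star w))) = w * (star w * w * g) * star w" by (simp add: mult.assoc)
  also have "\<dots> = s *\<^sub>R (w * (g * star w)) - w * star w" by (simp only: 1) (simp add: algebra_simps)
  finally have 3: "w * (star w * (w * (g * star w))) = s *\<^sub>R (w * (g * star w)) - w * star w" .
  have "w * (g * (star w * (w * star w))) = w * (g * (star w * w)) * star w" by (simp add: mult.assoc)
  also have "\<dots> = s *\<^sub>R (w * (g * star w)) - w * star w" by (simp only: 2) (simp add: algebra_simps)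
  finally have 4: "w * (g * (star w * (w * star w))) = s *\<^sub>R (w * (g * star w)) - w * star w" .
  have "(of_real s - w * star w) * (1 + w * g * star w) = of_real s"
    "(1 + w * g * star w) * (of_real s - w * star w) = of_real s"
    by (simp_all add: algebra_simps 3 4 of_real_def)
  then have "(of_real s - w * star w) * ((1/s) *\<^sub>R (1 + w * g * star w)) = 1"
    "((1/s) *\<^sub>R (1 + w * g * star w)) * (of_real s - w * star w) = 1"
    using s by (simp_all add: of_real_def)
  then have "has_inverse (of_real s - w * star w)" unfolding has_inverse_def by blast
  then show "has_inverse (- (w * star w) + of_real s)" by simp
qed (simp add: star_minus star_mult star_star)

lemma real_imag_parts:
  fixes w :: "'a::cstar_algebra"
  obtains a b where "star a = a" "star b = b" "w = a + \<i> *\<^sub>C b"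
proof -
  define a b where "a = (1/2) *\<^sub>R (w + star w)" and "b = (1/2) *\<^sub>R (\<i> *\<^sub>C (star w - w))"
  have "\<i> *\<^sub>C b = (1/2) *\<^sub>R (w - star w)"
    by (simp add: b_def scaleC_scaleR scaleC_scaleC scaleC_minus_left scaleC_diff_right)
  then have "w = a + \<i> *\<^sub>C b"
    by (simp add: a_def flip: scaleR_add_right)
  then show ?thesis
    by (intro that[of a b])
       (simp_all add: a_def b_def star_scaleR star_add star_diff star_star star_scaleC scaleC_minus_left
          scaleC_diff_right add.commute)
qed

text \<open>Kaplansky's argument. With v the negative part of \<open>star z * z\<close> and w = z v,
  \<open>star w * w\<close> is -v^3, so both products of w with its adjoint are negative. Their sum
  is 2(a^2 + b^2) for the real and imaginary parts, hence positive. So v^3 = 0 and v = 0.\<close>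

lemma psd_star_mult_unital:
  fixes z :: "'a::cstar_algebra_1"
  shows "psd (star z * z)"
proof -
  obtain u v where uv: "psd u" "psd v" "star z * z = u - v" "u * v = 0" "v * u = 0"
    by (rule pos_neg_parts[of "star z * z"]) (auto simp: star_mult star_star)
  define w where "w = z * v"
  have sv: "star v = v" using uv by (simp add: psd_self_adjoint)
  have "star w * w = v * (star z * z) * v" by (simp add: w_def star_mult sv mult.assoc)
  also have "\<dots> = - (v * v * v)" by (simp add: uv algebra_simps)
  finally have ww: "star w * w = - (v * v * v)" .
  have "psd (v * v * v)" by (intro psd_mult_commute psd_square uv sv) (simp add: mult.assoc)
  then have 1: "psd (- (star w * w))" by (simp add: ww)
  then have 2: "psd (- (w * star w))" by (rule psd_minus_mult_star)
  obtain a b where ab: "star a = a" "star b = b" "w = a + \<i> *\<^sub>C b" by (rule real_imag_parts)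
  have "star w * w + w * star w = 2 *\<^sub>R (a * a + b * b)"
    by (simp add: ab star_add star_scaleC scaleC_minus_left algebra_simps mult_scaleC_left mult_scaleC_right
       scaleC_scaleC scaleC_diff_right scaleC_add_right scaleR_2)
  then have "star w * w = 2 *\<^sub>R (a * a + b * b) + (- (w * star w))" by (simp add: algebra_simps)
  moreover have "psd \<dots>" by (intro psd_add_unital psd_scaleR psd_square ab 2) auto
  ultimately have "star w * w = 0" using psd_antisym_unital 1 by metis
  then have "v * v * v = 0" using ww by simp
  then have "(v * v) * (v * v) = 0" by (simp add: mult.assoc)
  then have "v = 0" using sv by (metis self_adjoint_square_eq_0 star_mult)
  then show ?thesis using uv by simp
qed

lemma psd_conj:
  fixes x :: "'a::cstar_algebra_1"
  assumes "psd x" shows "psd (star b * x * b)"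
proof -
  obtain y where y: "star y = y" "x = y * y" using assms by (auto simp: psd_def)
  have "star b * x * b = star (y * b) * (y * b)" by (simp add: y star_mult mult.assoc)
  then show ?thesis by (simp add: psd_star_mult_unital)
qed

text \<open>For x = y^2 and w a square root of z, x - z = (y - w)(y + w). If z is not a nonnegative
  real, w is not real, and y - w is invertible as a factor of (y - Re w)^2 + (Im w)^2. The converse
  tests negative reals z only.\<close>

lemma psd_iff_spectrum:
  fixes x :: "'a::cstar_algebra_1"
  shows "psd x \<longleftrightarrow> star x = x \<and> (\<forall>z. z \<notin> complex_of_real ` {0..} \<longrightarrow> has_inverse (x - z *\<^sub>C 1))"
proof (intro iffI conjI allI impI)
  fix z assume x: "psd x" and z: "z \<notin> complex_of_real ` {0..}"
  obtain y where y: "star y = y" "x = y * y" using x by (auto simp: psd_def)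
  define w where "w = csqrt z"
  have ww: "z = w * w" by (metis w_def power2_csqrt power2_eq_square)
  have im: "Im w \<noteq> 0"
  proof
    assume "Im w = 0"
    then have "z = complex_of_real (Re w * Re w)" by (simp add: ww complex_eq_iff)
    with z show False by (metis atLeast_iff imageI zero_le_square)
  qed
  have inv: "has_inverse (y - w *\<^sub>C 1)" if im: "Im w \<noteq> 0" for w
  proof -
    define a where "a = y - of_real (Re w)"
    have weq: "complex_of_real (Re w) + complex_of_real (Im w) * \<i> = w"
      by (simp add: complex_eq_iff)
    have "(complex_of_real (Re w) + complex_of_real (Im w) * \<i>) *\<^sub>C (1::'a)
        = of_real (Re w) + Im w *\<^sub>R (\<i> *\<^sub>C 1)"
      by (simp only: scaleC_add_left scaleC_scaleC[symmetric] scaleR_scaleC[symmetric] of_real_def[where 'a = 'a])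
    then have eq: "y - w *\<^sub>C 1 = a - Im w *\<^sub>R (\<i> *\<^sub>C 1)" by (simp add: a_def weq)
    have sa: "star a = a" by (simp add: a_def star_diff y)
    have "has_inverse (a * a + of_real ((Im w)\<^sup>2))"
      using im by (intro psd_has_inverse_add psd_square sa) auto
    moreover define i where "i = Im w *\<^sub>R (\<i> *\<^sub>C (1::'a))"
    have "i * i = - of_real ((Im w)\<^sup>2)" "a * i = i * a"
      by (simp_all add: i_def mult_scaleC_left mult_scaleC_right scaleC_scaleC scaleC_minus_left scaleC_scaleR of_real_def power2_eq_square)
    then have "a * a + of_real ((Im w)\<^sup>2) = (a - i) * (a + i)" "a * a + of_real ((Im w)\<^sup>2) = (a + i) * (a - i)"
      by (simp_all add: left_diff_distrib right_diff_distrib distrib_left distrib_right)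
    ultimately have "has_inverse (a - i)" by (metis has_inverse_factor)
    then show ?thesis by (simp add: eq i_def)
  qed
  have "has_inverse ((y - w *\<^sub>C 1) * (y - (- w) *\<^sub>C 1))"
    using im by (intro has_inverse_mult inv) auto
  moreover have "(y - w *\<^sub>C 1) * (y - (- w) *\<^sub>C 1) = x - z *\<^sub>C 1"
    by (simp add: ww y algebra_simps mult_scaleC_left mult_scaleC_right scaleC_scaleC scaleC_minus_left
      scaleC_add_right scaleC_diff_right)
  ultimately show "has_inverse (x - z *\<^sub>C 1)" by simp
next
  assume x: "star x = x \<and> (\<forall>z. z \<notin> complex_of_real ` {0..} \<longrightarrow> has_inverse (x - z *\<^sub>C 1))"
  show "psd x"
  proof (rule psd_if_has_inverse)
    fix s :: real assume "s > 0"
    then have "complex_of_real (- s) \<notin> complex_of_real ` {0..}" by (auto simp: complex_eq_iff)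
    with x have "has_inverse (x - complex_of_real (- s) *\<^sub>C 1)" by blast
    moreover have "complex_of_real (- s) *\<^sub>C (1::'a) = - of_real s"
      by (simp only: scaleR_scaleC[symmetric] of_real_def[where 'a = 'a] scaleR_minus_left)
    ultimately show "has_inverse (x + of_real s)" by simp
  qed (use x in blast)
qed (rule psd_self_adjoint)

subsection \<open>The unitization\<close>

lemma scaleR_scaleC_left: "(r *\<^sub>R z) *\<^sub>C x = r *\<^sub>R (z *\<^sub>C x :: 'a::cstar_algebra)"
  by (simp only: scaleR_scaleC[of r "z *\<^sub>C x"] scaleC_scaleC scaleR_conv_of_real)

text \<open>A fresh type instead of pairs, since the product type already carries a norm, the
  Euclidean one.\<close>

datatype 'a unitization = Unitization (base: 'a) (scalar: complex)

lemma unitization_eqI: "base u = base v \<Longrightarrow> scalar u = scalar v \<Longrightarrow> u = v"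
  by (cases u, cases v) simp

instantiation unitization :: (cstar_algebra) real_algebra_1
begin

definition "0 = Unitization 0 0"
definition "1 = Unitization 0 1"
definition "u + v = Unitization (base u + base v) (scalar u + scalar v)"
definition "u - v = Unitization (base u - base v) (scalar u - scalar v)"
definition "- u = Unitization (- base u) (- scalar u)"
definition "u * v = Unitization (base u * base v + scalar v *\<^sub>C base u + scalar u *\<^sub>C base v) (scalar u * scalar v)"
definition "r *\<^sub>R u = Unitization (r *\<^sub>R base u) (r *\<^sub>R scalar u)"

instance
  by standard
    (auto simp: zero_unitization_def one_unitization_def plus_unitization_def minus_unitization_def
      uminus_unitization_def times_unitization_def scaleR_unitization_def algebra_simps
      scaleC_add_left scaleC_add_right scaleC_scaleC mult_scaleC_left mult_scaleC_right
      scaleC_scaleR scaleR_scaleC_left)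

end

lemma base_simps [simp]:
  fixes u v :: "'a::cstar_algebra unitization"
  shows "base (0 :: 'a unitization) = 0" "base (1 :: 'a unitization) = 0"
    "base (u + v) = base u + base v" "base (u - v) = base u - base v"
    "base (- u) = - base u" "base (r *\<^sub>R u) = r *\<^sub>R base u"
    "base (u * v) = base u * base v + scalar v *\<^sub>C base u + scalar u *\<^sub>C base v"
  by (simp_all add: zero_unitization_def one_unitization_def plus_unitization_def minus_unitization_def
      uminus_unitization_def times_unitization_def scaleR_unitization_def)

lemma scalar_simps [simp]:
  fixes u v :: "'a::cstar_algebra unitization"
  shows "scalar (0 :: 'a unitization) = 0" "scalar (1 :: 'a unitization) = 1"
    "scalar (u + v) = scalar u + scalar v" "scalar (u - v) = scalar u - scalar v"
    "scalar (- u) = - scalar u" "scalar (r *\<^sub>R u) = r *\<^sub>R scalar u"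
    "scalar (u * v) = scalar u * scalar v"
  by (simp_all add: zero_unitization_def one_unitization_def plus_unitization_def minus_unitization_def
      uminus_unitization_def times_unitization_def scaleR_unitization_def)

text \<open>The unitization acts by left multiplication on the algebra, which is an ideal in it; the
  operator norm of this action is the natural candidate for a C*-norm.\<close>

definition unit_op :: "'a::cstar_algebra unitization \<Rightarrow> 'a \<Rightarrow> 'a"
  where "unit_op u b = base u * b + scalar u *\<^sub>C b"

lemma bounded_linear_unit_op: "bounded_linear (unit_op u)"
proof (rule bounded_linear_intro[where K = "norm (base u) + cmod (scalar u)"])
  show "norm (unit_op u x) \<le> norm x * (norm (base u) + cmod (scalar u))" for x
  proof -
    have "norm (unit_op u x) \<le> norm (base u * x) + norm (scalar u *\<^sub>C x)"
      unfolding unit_op_def by (rule norm_triangle_ineq)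
    also have "\<dots> \<le> norm (base u) * norm x + cmod (scalar u) * norm x"
      by (intro add_mono norm_mult_ineq) (simp add: norm_scaleC)
    finally show ?thesis by (simp add: algebra_simps)
  qed
qed (simp_all add: unit_op_def scaleC_add_right scaleC_scaleR algebra_simps)

lemma unit_op_simps:
  "unit_op (u + v) b = unit_op u b + unit_op v b"
  "unit_op (r *\<^sub>R u) b = r *\<^sub>R unit_op u b"
  "unit_op (u * v) b = unit_op u (unit_op v b)"
  by (simp_all add: unit_op_def scaleC_add_left scaleC_add_right scaleC_scaleC mult_scaleC_left
      mult_scaleC_right algebra_simps scaleR_scaleC_left)

text \<open>
  The operator norm alone would only be a seminorm if the algebra already has a unit; the maximum
  with the modulus of the scalar part is a C*-norm in every case.
\<close>

instantiation unitization :: (cstar_algebra) real_normed_algebra_1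
begin

definition "norm u = max (cmod (scalar u)) (onorm (unit_op u))"
definition "sgn u = u /\<^sub>R norm (u :: 'a unitization)"
definition "dist u v = norm (u - v :: 'a unitization)"
definition "(uniformity :: ('a unitization \<times> 'a unitization) filter) =
  (INF e\<in>{0 <..}. principal {(x, y). dist x y < e})"
definition "open (U :: 'a unitization set) \<longleftrightarrow>
  (\<forall>x\<in>U. eventually (\<lambda>(x', y). x' = x \<longrightarrow> y \<in> U) uniformity)"

instance
proof
  fix u v :: "'a unitization" and r :: real
  have comp: "unit_op (x * y) = unit_op x \<circ> unit_op y" for x y :: "'a unitization"
    by (auto simp: unit_op_simps)
  show "norm u = 0 \<longleftrightarrow> u = 0"
  proof
    assume "norm u = 0"
    then have "cmod (scalar u) \<le> 0" and n: "onorm (unit_op u) \<le> 0"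
      unfolding norm_unitization_def by linarith+
    then have s: "scalar u = 0" by simp
    \<comment> \<open>With zero scalar part the operator is left multiplication by
      \<open>base u\<close>; testing it at the adjoint brings in the C*-identity.\<close>
    have "norm (unit_op u (star (base u))) \<le> 0"
      using onorm[OF bounded_linear_unit_op, of u "star (base u)"] mult_nonpos_nonneg[OF n norm_ge_zero]
      by (rule order_trans)
    then have "star (star (base u)) * star (base u) = 0" by (simp add: unit_op_def s star_star)
    then have "star (base u) = 0" by (rule star_mult_self_eq_0)
    then have "base u = 0" by (metis star_star star_zero)
    with s show "u = 0" by (intro unitization_eqI) auto
  next
    assume "u = 0"
    then have "unit_op u = (\<lambda>_. 0)" by (auto simp: unit_op_def)
    with \<open>u = 0\<close> show "norm u = 0" by (simp add: norm_unitization_def onorm_zero)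
  qed
  have "onorm (unit_op (u + v)) \<le> onorm (unit_op u) + onorm (unit_op v)"
    using onorm_triangle[OF bounded_linear_unit_op bounded_linear_unit_op, of u v]
    by (simp add: unit_op_simps[abs_def])
  then show "norm (u + v) \<le> norm u + norm v"
    using norm_triangle_ineq[of "scalar u" "scalar v"]
    unfolding norm_unitization_def scalar_simps by linarith
  show "norm (r *\<^sub>R u) = \<bar>r\<bar> * norm u"
    unfolding norm_unitization_def
    using onorm_scaleR[OF bounded_linear_unit_op, of r u]
    by (simp add: unit_op_simps[abs_def] max_mult_distrib_left)
  show "norm (u * v) \<le> norm u * norm v"
  proof -
    have "cmod (scalar (u * v)) \<le> norm u * norm v"
      unfolding norm_unitization_def scalar_simps norm_mult
      by (intro mult_mono) (auto simp: le_max_iff_disj)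
    moreover have "onorm (unit_op (u * v)) \<le> norm u * norm v"
    proof -
      have "onorm (unit_op (u * v)) \<le> onorm (unit_op u) * onorm (unit_op v)"
        unfolding comp by (rule onorm_compose[OF bounded_linear_unit_op bounded_linear_unit_op])
      also have "\<dots> \<le> norm u * norm v"
        unfolding norm_unitization_def
        by (intro mult_mono) (auto simp: onorm_pos_le[OF bounded_linear_unit_op] le_max_iff_disj)
      finally show ?thesis .
    qed
    ultimately show ?thesis by (simp add: norm_unitization_def[of "u * v"])
  qed
  have "unit_op (1 :: 'a unitization) = (\<lambda>x. x)" by (auto simp: unit_op_def)
  then show "norm (1 :: 'a unitization) = 1"
    using onorm_id_le[where 'a = 'a] by (simp add: norm_unitization_def max_def)
qed (auto simp: sgn_unitization_def dist_unitization_def uniformity_unitization_def open_unitization_def)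

end

text \<open>Left multiplication by a attains the norm of a at \<open>star a\<close>, by the
  C*-identity.\<close>

lemma norm_Unitization: "norm (Unitization a 0) = norm (a :: 'a::cstar_algebra)"
proof -
  have op: "unit_op (Unitization a 0) = (\<lambda>b. a * b)" by (auto simp: unit_op_def)
  have bl: "bounded_linear (\<lambda>b. a * b)" by (rule bounded_linear_mult_right)
  have "onorm (\<lambda>b. a * b) = norm a"
  proof (rule antisym)
    show "onorm (\<lambda>b. a * b) \<le> norm a" by (rule onorm_bound) (auto simp: norm_mult_ineq)
    have "norm a * norm a = norm (star (star a) * star a)"
      by (simp add: cstar_identity norm_star power2_eq_square)
    also have "\<dots> \<le> onorm (\<lambda>b. a * b) * norm (star a)"
      using onorm[OF bl, of "star a"] by (simp add: star_star)
    finally have "norm a * norm a \<le> onorm (\<lambda>b. a * b) * norm a" by (simp add: norm_star)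
    then show "norm a \<le> onorm (\<lambda>b. a * b)"
      using onorm_pos_le[OF bl] by (cases "a = 0") auto
  qed
  then show ?thesis by (simp add: norm_unitization_def op onorm_pos_le[OF bl])
qed

lemma norm_scalar_le: "cmod (scalar u) \<le> norm u"
  by (simp add: norm_unitization_def)

lemma Unitization_split: "Unitization (base u) 0 + Unitization 0 (scalar u) = (u :: 'a::cstar_algebra unitization)"
  by (intro unitization_eqI) auto

lemma norm_Unitization_scalar: "norm (Unitization (0::'a::cstar_algebra) z) = cmod z"
proof -
  have op: "unit_op (Unitization (0::'a) z) = (\<lambda>b. z *\<^sub>C b)" by (auto simp: unit_op_def)
  have "onorm (\<lambda>b::'a. z *\<^sub>C b) \<le> cmod z" by (rule onorm_bound) (auto simp: norm_scaleC)
  then show ?thesis by (simp add: norm_unitization_def op)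
qed

lemma norm_base_le: "norm (base u) \<le> 2 * norm (u :: 'a::cstar_algebra unitization)"
proof -
  have "Unitization (base u) 0 = u - Unitization 0 (scalar u)"
    by (intro unitization_eqI) auto
  then have "norm (base u) \<le> norm u + cmod (scalar u)"
    by (metis norm_Unitization norm_Unitization_scalar norm_triangle_ineq4)
  then show ?thesis using norm_scalar_le[of u] by simp
qed

lemma bounded_linear_Unitization: "bounded_linear (\<lambda>a::'a::cstar_algebra. Unitization a 0)"
  by (rule bounded_linear_intro[where K = 1])
    (auto simp: norm_Unitization plus_unitization_def scaleR_unitization_def)

instance unitization :: (cstar_algebra) banach
proof
  fix X :: "nat \<Rightarrow> 'a unitization"
  assume X: "Cauchy X"
  have "bounded_linear (base :: 'a unitization \<Rightarrow> 'a)"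
    by (rule bounded_linear_intro[where K = 2]) (use norm_base_le in \<open>auto simp: mult.commute\<close>)
  from bounded_linear.Cauchy[OF this X] obtain a where a: "(\<lambda>n. base (X n)) \<longlonglongrightarrow> a"
    using Cauchy_convergent convergent_def by blast
  have "bounded_linear (scalar :: 'a unitization \<Rightarrow> complex)"
    by (rule bounded_linear_intro[where K = 1]) (auto simp: norm_scalar_le)
  from bounded_linear.Cauchy[OF this X] obtain z where z: "(\<lambda>n. scalar (X n)) \<longlonglongrightarrow> z"
    using Cauchy_convergent convergent_def by blast
  have sc: "bounded_linear (\<lambda>z. Unitization (0::'a) z)"
    by (rule bounded_linear_intro[where K = 1])
      (auto simp: norm_Unitization_scalar plus_unitization_def scaleR_unitization_def)
  have "(\<lambda>n. Unitization (base (X n)) 0 + Unitization 0 (scalar (X n))) \<longlonglongrightarrow> Unitization a 0 + Unitization 0 z"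
    by (intro tendsto_add bounded_linear.tendsto[OF bounded_linear_Unitization] bounded_linear.tendsto[OF sc] a z)
  then show "convergent X" unfolding Unitization_split by (auto simp: convergent_def)
qed

instantiation unitization :: (cstar_algebra) cstar_algebra_1
begin

definition "z *\<^sub>C u = Unitization (z *\<^sub>C base u) (z * scalar u)"
definition "star u = Unitization (star (base u)) (cnj (scalar u))"

instance
proof
  fix u v :: "'a unitization" and z w :: complex and r :: real
  show "z *\<^sub>C (u + v) = z *\<^sub>C u + z *\<^sub>C v" "(z + w) *\<^sub>C u = z *\<^sub>C u + w *\<^sub>C u"
    and zw: "\<And>z w. z *\<^sub>C w *\<^sub>C u = (z * w) *\<^sub>C u"
    and "(z *\<^sub>C u) * v = z *\<^sub>C (u * v)" "u * (z *\<^sub>C v) = z *\<^sub>C (u * v)"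
    by (rule unitization_eqI; simp add: scaleC_unitization_def scaleC_add_left scaleC_add_right scaleC_scaleC
        mult_scaleC_left mult_scaleC_right algebra_simps)+
  show "r *\<^sub>R u = complex_of_real r *\<^sub>C u"
    by (rule unitization_eqI) (simp_all add: scaleC_unitization_def scaleR_conv_of_real[where 'a = complex] flip: scaleR_scaleC)
  show "star (u * v) = star v * star u"
    by (rule unitization_eqI) (simp_all add: star_unitization_def star_add star_mult star_scaleC)
  show "star (u + v) = star u + star v" "star (z *\<^sub>C u) = cnj z *\<^sub>C star u"
    and ss: "\<And>u :: 'a unitization. star (star u) = u"
    by (rule unitization_eqI; simp add: star_unitization_def scaleC_unitization_def star_add star_scaleC star_star)+
  have le: "norm (z *\<^sub>C u) \<le> cmod z * norm u" for z and u :: "'a unitization"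
  proof -
    have op: "unit_op (z *\<^sub>C u) = (\<lambda>b. z *\<^sub>C unit_op u b)"
      by (auto simp: unit_op_def scaleC_unitization_def scaleC_add_right mult_scaleC_left scaleC_scaleC)
    have "onorm (\<lambda>b. z *\<^sub>C unit_op u b) \<le> cmod z * onorm (unit_op u)"
      by (rule onorm_bound)
        (auto simp: norm_scaleC mult.assoc onorm_pos_le onorm bounded_linear_unit_op intro!: mult_left_mono)
    then have "onorm (unit_op (z *\<^sub>C u)) \<le> cmod z * norm u"
      unfolding op norm_unitization_def by (rule order_trans) (auto intro!: mult_left_mono)
    moreover have "cmod (scalar (z *\<^sub>C u)) \<le> cmod z * norm u"
      by (auto simp: scaleC_unitization_def norm_mult norm_scalar_le intro!: mult_left_mono)
    ultimately show ?thesis by (simp add: norm_unitization_def[of "z *\<^sub>C u"])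
  qed
  show "norm (z *\<^sub>C u) = cmod z * norm u"
  proof (cases "z = 0")
    case False
    have "inverse z *\<^sub>C z *\<^sub>C u = u"
      using False zw by (intro unitization_eqI) (simp_all add: scaleC_unitization_def)
    then have "norm u \<le> inverse (cmod z) * norm (z *\<^sub>C u)"
      using le[of "inverse z" "z *\<^sub>C u"] by (simp add: norm_inverse)
    then have "cmod z * norm u \<le> norm (z *\<^sub>C u)"
      using False by (simp add: field_simps)
    with le show ?thesis by (rule antisym)
  qed (use le[of 0 u] in simp)
  \<comment> \<open>This inequality suffices: with submultiplicativity it yields first that
    \<open>star\<close> is isometric and then the C*-identity. For the operator part, (norm (u b))^2
    is the norm of \<open>star b * unit_op (star u * u) b\<close>, by the C*-identity in the
    algebra.\<close>
  have sq: "(norm u)\<^sup>2 \<le> norm (star u * u)" for u :: "'a unitization"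
  proof -
    define K where "K = onorm (unit_op (star u * u))"
    have K: "K \<ge> 0" unfolding K_def by (rule onorm_pos_le[OF bounded_linear_unit_op])
    have "norm (unit_op u b) \<le> sqrt K * norm b" for b
    proof (rule power2_le_imp_le)
      have "star (unit_op u b) * unit_op u b = star b * unit_op (star u * u) b"
        by (simp add: unit_op_def star_unitization_def star_add star_mult star_scaleC algebra_simps
            mult_scaleC_left mult_scaleC_right scaleC_add_right scaleC_add_left scaleC_scaleC)
      then have "(norm (unit_op u b))\<^sup>2 = norm (star b * unit_op (star u * u) b)"
        by (metis cstar_identity)
      also have "\<dots> \<le> norm b * norm (unit_op (star u * u) b)"
        by (metis norm_mult_ineq norm_star)
      also have "\<dots> \<le> norm b * (K * norm b)"
        unfolding K_def by (intro mult_left_mono onorm[OF bounded_linear_unit_op]) auto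
      also have "\<dots> = (sqrt K * norm b)\<^sup>2" using K by (simp add: power2_eq_square)
      finally show "(norm (unit_op u b))\<^sup>2 \<le> (sqrt K * norm b)\<^sup>2" .
    qed (use K in simp)
    then have "onorm (unit_op u) \<le> sqrt K" using K by (intro onorm_bound) auto
    then have "(onorm (unit_op u))\<^sup>2 \<le> (sqrt K)\<^sup>2"
      by (intro power_mono onorm_pos_le[OF bounded_linear_unit_op])
    then have 1: "(onorm (unit_op u))\<^sup>2 \<le> norm (star u * u)"
      using K unfolding norm_unitization_def[of "star u * u"] by (simp add: K_def)
    have "cmod (scalar (star u * u)) = (cmod (scalar u))\<^sup>2"
      by (simp add: star_unitization_def norm_mult power2_eq_square)
    then have 2: "(cmod (scalar u))\<^sup>2 \<le> norm (star u * u)"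
      using norm_scalar_le[of "star u * u"] by simp
    from 1 2 show ?thesis by (simp add: norm_unitization_def[of u] max_def)
  qed
  have "norm u \<le> norm (star u)" for u :: "'a unitization"
  proof (cases "u = 0")
    case False
    have "norm u * norm u \<le> norm (star u) * norm u"
      using sq[of u] norm_mult_ineq[of "star u" u] by (simp add: power2_eq_square)
    with False show ?thesis by simp
  qed simp
  from this[of u] this[of "star u"] have "norm (star u) = norm u" by (simp add: ss)
  then show "norm (star u * u) = (norm u)\<^sup>2"
    using sq[of u] norm_mult_ineq[of "star u" u] by (simp add: power2_eq_square)
qed

end

subsection \<open>Positive elements of a C*-algebra\<close>

definition emb :: "'a::cstar_algebra \<Rightarrow> 'a unitization"
  where "emb a = Unitization a 0"

lemma base_emb [simp]: "base (emb a) = a" and scalar_emb [simp]: "scalar (emb a) = 0"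
  by (simp_all add: emb_def)

lemma emb_base: "scalar u = 0 \<Longrightarrow> emb (base u) = u"
  by (rule unitization_eqI) auto

lemma emb_0 [simp]: "emb 0 = 0"
  and emb_add: "emb (a + b) = emb a + emb b"
  and emb_diff: "emb (a - b) = emb a - emb b"
  and emb_minus: "emb (- a) = - emb a"
  and emb_mult: "emb (a * b) = emb a * emb b"
  and emb_scaleR: "emb (r *\<^sub>R a) = r *\<^sub>R emb a"
  and emb_star: "emb (star a) = star (emb a)"
  by (rule unitization_eqI; simp add: star_unitization_def)+

lemmas emb_simps = emb_add emb_diff emb_minus emb_mult emb_scaleR emb_star

lemma norm_emb [simp]: "norm (emb a) = norm a"
  by (simp add: emb_def norm_Unitization)

lemma emb_inject [simp]: "emb a = emb b \<longleftrightarrow> a = b"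
  by (metis base_emb)

lemma emb_eq_0_iff [simp]: "emb a = 0 \<longleftrightarrow> a = 0"
  using emb_inject[of a 0] by simp

text \<open>If y^2 has scalar part 0, so has y; a square root taken in the unitization therefore
  lies in the algebra.\<close>

lemma psd_emb [simp]: "psd (emb x) \<longleftrightarrow> psd x"
proof
  assume "psd (emb x)"
  then obtain y where y: "star y = y" "emb x = y * y" by (auto simp: psd_def)
  have "scalar y * scalar y = 0" by (metis scalar_emb scalar_simps(7) y(2))
  then have "y = emb (base y)" by (simp add: emb_base)
  then show "psd x" using y unfolding psd_def by (metis emb_inject emb_mult emb_star)
next
  assume "psd x"
  then obtain y where y: "star y = y" "x = y * y" by (auto simp: psd_def)
  have "star (emb y) = emb y" by (simp add: y(1) flip: emb_star)
  then show "psd (emb x)" using psd_square[of "emb y"] by (simp add: y(2) emb_mult)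
qed

lemma positive_cone_iff: "x \<in> positive_cone \<longleftrightarrow> psd x"
proof -
  have "(z \<in> spectrum x) = (\<not> has_inverse (emb x - z *\<^sub>C 1))" for z
  proof -
    have eq: "unitization_mult (x, - z) u = (0, 1) \<longleftrightarrow> (emb x - z *\<^sub>C 1) * Unitization (fst u) (snd u) = 1"
      "unitization_mult u (x, - z) = (0, 1) \<longleftrightarrow> Unitization (fst u) (snd u) * (emb x - z *\<^sub>C 1) = 1" for u
      by (auto simp: unitization_mult_def emb_def scaleC_unitization_def one_unitization_def
          times_unitization_def minus_unitization_def)
    have "(\<exists>u. unitization_mult (x, - z) u = (0, 1) \<and> unitization_mult u (x, - z) = (0, 1))
      \<longleftrightarrow> has_inverse (emb x - z *\<^sub>C 1)"
    proof
      assume "has_inverse (emb x - z *\<^sub>C 1)"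
      then obtain y where "(emb x - z *\<^sub>C 1) * y = 1" "y * (emb x - z *\<^sub>C 1) = 1"
        unfolding has_inverse_def by blast
      then show "\<exists>u. unitization_mult (x, - z) u = (0, 1) \<and> unitization_mult u (x, - z) = (0, 1)"
        by (intro exI[of _ "(base y, scalar y)"]) (simp only: eq fst_conv snd_conv unitization.collapse simp_thms)
    qed (auto simp only: eq has_inverse_def)
    then show ?thesis unfolding spectrum_def by (simp only: mem_Collect_eq)
  qed
  then have "spectrum x \<subseteq> complex_of_real ` {0..} \<longleftrightarrow>
      (\<forall>z. z \<notin> complex_of_real ` {0..} \<longrightarrow> has_inverse (emb x - z *\<^sub>C 1))" by blast
  then show ?thesis
    using psd_iff_spectrum[of "emb x"] by (simp add: positive_cone_def flip: emb_star)
qed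

lemma psd_add: "psd x \<Longrightarrow> psd y \<Longrightarrow> psd (x + y :: 'a::cstar_algebra)"
  using psd_add_unital[of "emb x" "emb y"] by (simp flip: emb_simps)

lemma closed_psd: "closed {x :: 'a::cstar_algebra. psd x}"
proof -
  have "closed (emb -` {x :: 'a unitization. psd x})"
    by (intro continuous_closed_vimage closed_psd_unital linear_continuous_at
        bounded_linear_Unitization[folded emb_def])
  then show ?thesis by (simp add: vimage_def)
qed

lemma psd_star_mult: "psd (star b * b :: 'a::cstar_algebra)"
  using psd_star_mult_unital[of "emb b"] by (simp flip: emb_simps)

lemma psd_norm_mono: "psd x \<Longrightarrow> psd (y - x) \<Longrightarrow> norm x \<le> norm (y :: 'a::cstar_algebra)"
  using psd_norm_mono_unital[of "emb x" "emb y"] by (simp flip: emb_simps)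

lemma psd_antisym: "psd x \<Longrightarrow> psd (- x) \<Longrightarrow> x = (0 :: 'a::cstar_algebra)"
  using psd_antisym_unital[of "emb x"] by (simp flip: emb_simps)

text \<open>Writing x = s^2, norm (x b) \<le> norm s * norm (s b), and (norm (s b))^2 is the norm of
  \<open>star b * x * b\<close>, which is monotone in x. This bounds x b uniformly over all x
  between 0 and y.\<close>

lemma norm_mult_square_le:
  fixes x y :: "'a::cstar_algebra_1"
  assumes x: "psd x" and yx: "psd (y - x)"
  shows "(norm (x * b))\<^sup>2 \<le> norm x * norm (star b * y * b)"
proof -
  obtain s where s: "star s = s" "x = s * s" using x by (auto simp: psd_def)
  have "(norm (s * b))\<^sup>2 = norm (star b * x * b)"
    using cstar_identity[of "s * b"] by (simp add: s star_mult mult.assoc)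
  also have "\<dots> \<le> norm (star b * y * b)"
    by (rule psd_norm_mono_unital) (use psd_conj[OF x] psd_conj[OF yx] in \<open>auto simp: algebra_simps\<close>)
  finally have "(norm s)\<^sup>2 * (norm (s * b))\<^sup>2 \<le> norm x * norm (star b * y * b)"
    by (simp add: s norm_self_adjoint_square mult_left_mono)
  moreover have "(norm (x * b))\<^sup>2 \<le> (norm s * norm (s * b))\<^sup>2"
    by (intro power_mono) (auto simp: s mult.assoc norm_mult_ineq)
  ultimately show ?thesis by (simp add: power_mult_distrib)
qed

section \<open>Orthogonal parts, approximate units and spectral cuts without a unit\<close>

lemma scalar_psd:
  assumes "psd u" obtains r where "r \<ge> 0" "scalar u = complex_of_real r"
proof -
  obtain y where y: "star y = y" "u = y * y" using assms by (auto simp: psd_def)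
  have "cnj (scalar y) = scalar y" using arg_cong[OF y(1), of scalar] by (simp add: star_unitization_def)
  then have "scalar u = complex_of_real ((Re (scalar y))\<^sup>2)"
    by (auto simp: y complex_eq_iff power2_eq_square)
  then show ?thesis by (intro that[of "(Re (scalar y))\<^sup>2"]) auto
qed

text \<open>The scalar part is multiplicative and nonnegative on positive elements, so its values
  satisfy a b = 0 and a - b = r \<le> 0, which forces a = 0. Hence the positive part of c - \<delta>
  belongs to the algebra.\<close>

lemma scalar_orthogonal_parts:
  assumes "psd u" "psd v" "u * v = 0" "scalar u - scalar v = complex_of_real r" "r \<le> 0"
  shows "scalar u = 0"
proof -
  obtain a b where ab: "a \<ge> 0" "b \<ge> 0" "scalar u = complex_of_real a" "scalar v = complex_of_real b"
    using scalar_psd[OF assms(1)] scalar_psd[OF assms(2)] by metis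
  have "scalar u * scalar v = 0" by (metis assms(3) scalar_simps(1,7))
  moreover have "a - b = r" using assms(4) ab by (metis of_real_diff of_real_eq_iff)
  ultimately show ?thesis using ab assms(5) by auto
qed

lemma orthogonal_decomposition:
  fixes x :: "'a::cstar_algebra"
  assumes "star x = x"
  obtains u v where "psd u" "psd v" "x = u - v" "u * v = 0" "v * u = 0"
    "\<And>p. x * p = x \<Longrightarrow> u * p = u" "\<And>p. x * p = x \<Longrightarrow> v * p = v"
proof -
  obtain u v where uv: "psd u" "psd v" "emb x = u - v" "u * v = 0" "v * u = 0"
    by (rule pos_neg_parts[of "emb x"]) (simp add: assms flip: emb_star)
  have d: "scalar u - scalar v = 0" using arg_cong[OF uv(3), of scalar] by simp
  have su: "scalar u = 0" by (rule scalar_orthogonal_parts[OF uv(1,2,4), of 0]) (use d in auto)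
  then have sv: "scalar v = 0" using d by simp
  define a b where "a = base u" and "b = base v"
  have ab: "u = emb a" "v = emb b" using su sv by (simp_all add: a_def b_def emb_base)
  have 1: "psd a" "psd b" "x = a - b" "a * b = 0" "b * a = 0"
    using uv unfolding ab by (simp_all flip: emb_simps)
  \<comment> \<open>Here a (a - a p) = a x' - a x' p = 0, so \<open>a - a * p\<close> has vanishing
    C*-square. Taking x' = x serves the positive part, x' = - x the negative one.\<close>
  have *: "a * p = a" if "x' * p = x'" "a * x' = a * a" "psd a" for x' a p :: 'a
  proof -
    have "a * (a - a * p) = a * x' - a * x' * p" by (simp add: that(2) algebra_simps)
    also have "\<dots> = 0" by (simp add: mult.assoc that(1))
    finally have "a * (a - a * p) = 0" .
    then have "star (a - a * p) * (a - a * p) = 0"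
      by (simp add: star_diff star_mult psd_self_adjoint[OF that(3)] left_diff_distrib mult.assoc)
    then show ?thesis using star_mult_self_eq_0 by force
  qed
  show ?thesis
  proof (rule that[OF 1])
    show "a * p = a" if "x * p = x" for p by (rule *[OF that]) (use 1 in \<open>simp_all add: right_diff_distrib\<close>)
    show "b * p = b" if "x * p = x" for p
    proof (rule *[of "- x"])
      show "- x * p = - x" by (simp only: mult_minus_left that)
    qed (use 1 in \<open>simp_all add: right_diff_distrib\<close>)
  qed
qed

text \<open>With g the inverse of h + \<delta>, e = h g = g h and h - e h = \<delta> e. The two
  forms of e give the last two clauses. The annihilated v ranges over the unitization because it
  will be the negative part of c - \<delta>, whose scalar part is \<delta>.\<close>

lemma approximate_unit:
  fixes h :: "'a::cstar_algebra"
  assumes h: "psd h" and d: "\<delta> > 0"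
  shows "\<exists>e. psd e \<and> psd (1 - emb e) \<and> norm e \<le> 1 \<and> norm (h - e * h) \<le> \<delta> \<and>
    (\<forall>v. emb h * v = 0 \<longrightarrow> emb e * v = 0) \<and> (\<forall>q. q * h = h \<longrightarrow> q * e = e)"
proof -
  define H where "H = emb h"
  have H: "psd H" using h by (simp add: H_def)
  obtain g where g: "(H + of_real \<delta>) * g = 1" "g * (H + of_real \<delta>) = 1"
    using psd_has_inverse_add[OF H d] by (auto simp: has_inverse_def)
  have Hg: "H * g = 1 - \<delta> *\<^sub>R g" "g * H = 1 - \<delta> *\<^sub>R g"
    using g by (simp_all add: algebra_simps of_real_def)
  have "star g * (H + of_real \<delta>) = 1"
    using arg_cong[OF g(1), of star] by (simp add: star_mult star_add psd_self_adjoint[OF H])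
  then have sg: "star g = g" by (metis g(1) mult.assoc mult.left_neutral mult.right_neutral)
  have "psd (star g * (H + of_real \<delta>) * g)"
    using d by (intro psd_conj psd_add_unital H psd_of_real) auto
  then have pg: "psd g" by (simp add: mult.assoc g sg)
  define E where "E = H * g"
  define e where "e = base E"
  have E: "E = emb e" unfolding e_def by (rule emb_base[symmetric]) (simp add: E_def H_def)
  have pE: "psd E" unfolding E_def by (rule psd_mult_commute[OF H pg]) (simp add: Hg)
  have p1: "psd (1 - E)" using psd_scaleR[OF pg] d by (simp add: E_def Hg)
  have n: "norm E \<le> 1" by (rule psd_norm_le[OF pE]) (use p1 in auto)
  have "H - E * H = H * (1 - g * H)" by (simp add: E_def algebra_simps)
  also have "\<dots> = \<delta> *\<^sub>R E" unfolding Hg(2) by (simp add: E_def)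
  finally have "H - E * H = \<delta> *\<^sub>R E" .
  then have "norm (H - E * H) \<le> \<delta>" using d n by (simp add: mult_left_le)
  moreover have "H - E * H = emb (h - e * h)" by (simp add: E H_def emb_simps)
  moreover have "emb e * v = 0" if "emb h * v = 0" for v
  proof -
    have "emb e * v = g * (H * v)" unfolding E[symmetric] E_def by (simp add: Hg flip: mult.assoc)
    then show ?thesis using that by (simp add: H_def)
  qed
  moreover have "q * e = e" if "q * h = h" for q
  proof -
    have "emb q * H = H" using that by (simp add: H_def flip: emb_mult)
    then have "emb q * E = E" by (simp add: E_def flip: mult.assoc)
    then show ?thesis by (simp add: E flip: emb_mult)
  qed
  ultimately show ?thesis using pE p1 n E by (intro exI[of _ e]) auto
qed

text \<open>u is the positive part of c - \<delta>, and k = c - u plays the role of min (c,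
  \<delta>). An e supported on u kills v, so c - \<delta> e = k (1 - e) + u with commuting positive
  factors. If u q = u, then c - c q = k (1 - q), and norm k \<le> \<delta>.\<close>

lemma spectral_cut:
  fixes c :: "'a::cstar_algebra"
  assumes c: "psd c" and d: "\<delta> > 0"
  shows "\<exists>u. psd u \<and>
    (\<forall>e. psd e \<longrightarrow> psd (1 - emb e) \<longrightarrow> (\<forall>v. emb u * v = 0 \<longrightarrow> emb e * v = 0) \<longrightarrow> psd (c - \<delta> *\<^sub>R e)) \<and>
    (\<forall>q. u * q = u \<longrightarrow> norm (c - c * q) \<le> \<delta> * (1 + norm q))"
proof -
  define C where "C = emb c"
  have C: "psd C" using c by (simp add: C_def)
  obtain u v where uv: "psd u" "psd v" "C - of_real \<delta> = u - v" "u * v = 0" "v * u = 0"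
    by (rule pos_neg_parts[of "C - of_real \<delta>"]) (simp add: star_diff psd_self_adjoint[OF C])
  have Ceq: "C = of_real \<delta> - v + u" using uv(3) by (simp add: algebra_simps)
  have "scalar u - scalar v = complex_of_real (- \<delta>)"
    using arg_cong[OF uv(3), of scalar] by (simp add: C_def of_real_def)
  then have "scalar u = 0" by (rule scalar_orthogonal_parts[OF uv(1,2,4)]) (use d in auto)
  define a where "a = base u"
  have a: "u = emb a" using \<open>scalar u = 0\<close> by (simp add: a_def emb_base)
  have sv: "star v = v" by (rule psd_self_adjoint[OF uv(2)])
  define k where "k = of_real \<delta> - v"
  \<comment> \<open>\<delta> k = k v + k^2, where k v = v C is a product of commuting positive
    elements.\<close>
  have k: "psd k"
  proof -
    have vC: "v * C = k * v" "C * v = k * v"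
      by (simp_all add: Ceq k_def algebra_simps uv of_real_def)
    have "psd (v * C)" by (rule psd_mult_commute[OF uv(2) C]) (simp add: vC)
    then have "psd (k * v + k * k)"
      by (intro psd_add_unital psd_square) (auto simp: vC k_def star_diff sv)
    moreover have "k * v + k * k = \<delta> *\<^sub>R k"
      by (simp add: k_def algebra_simps of_real_def)
    ultimately have "psd (\<delta> *\<^sub>R k)" by simp
    from psd_scaleR[OF this, of "1 / \<delta>"] show ?thesis using d by simp
  qed
  have nk: "norm k \<le> \<delta>" by (rule psd_norm_le[OF k]) (use uv d in \<open>auto simp: k_def\<close>)
  have "psd (c - \<delta> *\<^sub>R e)"
    if e: "psd e" "psd (1 - emb e)" "\<And>w. emb a * w = 0 \<Longrightarrow> emb e * w = 0" for e
  proof -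
    have ev: "emb e * v = 0" using e(3) uv(4) by (simp add: a)
    have "star (emb e) = emb e" using e(1) by (intro psd_self_adjoint) simp
    with arg_cong[OF ev, of star] have ve: "v * emb e = 0" by (simp add: star_mult sv)
    have "psd (k * (1 - emb e))"
      by (rule psd_mult_commute[OF k e(2)]) (simp add: k_def algebra_simps ev ve of_real_def)
    then have "psd (k * (1 - emb e) + u)" by (rule psd_add_unital[OF _ uv(1)])
    moreover have "k * (1 - emb e) + u = emb (c - \<delta> *\<^sub>R e)"
      by (simp add: emb_simps flip: C_def) (simp add: Ceq k_def algebra_simps ve of_real_def)
    ultimately show ?thesis by simp
  qed
  moreover have "norm (c - c * q) \<le> \<delta> * (1 + norm q)" if q: "a * q = a" for q
  proof -
    have uq: "u * emb q = u" using q by (simp add: a flip: emb_mult)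
    have "emb (c - c * q) = k * (1 - emb q)"
      by (simp add: emb_simps flip: C_def) (simp add: Ceq k_def algebra_simps uq)
    then have "norm (c - c * q) \<le> norm k * norm (1 - emb q)" by (metis norm_emb norm_mult_ineq)
    also have "\<dots> \<le> \<delta> * (1 + norm q)"
      using norm_triangle_ineq4[of 1 "emb q"] d nk by (intro mult_mono) auto
    finally show ?thesis .
  qed
  ultimately show ?thesis using uv(1) by (intro exI[of _ a]) (auto simp: a)
qed

subsection \<open>The Hahn--Banach theorem and the weak topology\<close>

definition sublinear :: "('a::real_vector \<Rightarrow> real) \<Rightarrow> bool"
  where "sublinear q \<longleftrightarrow> (\<forall>x y. q (x + y) \<le> q x + q y) \<and> (\<forall>r\<ge>0. \<forall>x. q (r *\<^sub>R x) = r * q x)"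

lemma sublinear_add: "sublinear q \<Longrightarrow> q (x + y) \<le> q x + q y"
  and sublinear_scaleR: "sublinear q \<Longrightarrow> r \<ge> 0 \<Longrightarrow> q (r *\<^sub>R x) = r * q x"
  by (auto simp: sublinear_def)

lemma sublinear_0: "sublinear q \<Longrightarrow> q 0 = 0"
  using sublinear_scaleR[of q 0 0] by simp

lemma sublinear_minus: "sublinear q \<Longrightarrow> - q (- x) \<le> q x"
  using sublinear_add[of q x "- x"] sublinear_0[of q] by simp

text \<open>
  The tilts of a sublinear functional \<open>q\<close> are sublinear and below \<open>q\<close>. A minimal \<open>q\<close> therefore equals
  its tilts, which makes it additive.
\<close>

definition tilt :: "('a::real_vector \<Rightarrow> real) \<Rightarrow> 'a \<Rightarrow> 'a \<Rightarrow> real"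
  where "tilt q y x = (INF t\<in>{0..}. q (x + t *\<^sub>R y) - t * q y)"

lemma tilt_lower:
  assumes "sublinear q" "t \<ge> 0"
  shows "- q (- x) \<le> q (x + t *\<^sub>R y) - t * q y"
  using sublinear_add[OF assms(1), of "x + t *\<^sub>R y" "- x"] sublinear_scaleR[OF assms, of y] by simp

lemma tilt_bdd: "sublinear q \<Longrightarrow> bdd_below ((\<lambda>t. q (x + t *\<^sub>R y) - t * q y) ` {0..})"
  using tilt_lower by (intro bdd_belowI2[where m = "- q (- x)"]) auto

lemma tilt_le: "sublinear q \<Longrightarrow> t \<ge> 0 \<Longrightarrow> tilt q y x \<le> q (x + t *\<^sub>R y) - t * q y"
  unfolding tilt_def by (intro cINF_lower tilt_bdd) auto

lemma tilt_greatest: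
  "(\<And>t. t \<ge> 0 \<Longrightarrow> m \<le> q (x + t *\<^sub>R y) - t * q y) \<Longrightarrow> m \<le> tilt q y x"
  unfolding tilt_def by (intro cINF_greatest) auto

lemma sublinear_tilt:
  assumes q: "sublinear q" shows "sublinear (tilt q y)"
  unfolding sublinear_def
proof (intro conjI allI impI)
  fix x x'
  have "tilt q y (x + x') - tilt q y x' \<le> tilt q y x"
  proof (rule tilt_greatest)
    fix t :: real assume t: "t \<ge> 0"
    have "tilt q y (x + x') - (q (x + t *\<^sub>R y) - t * q y) \<le> tilt q y x'"
    proof (rule tilt_greatest)
      fix t' :: real assume t': "t' \<ge> 0"
      have "tilt q y (x + x') \<le> q (x + x' + (t + t') *\<^sub>R y) - (t + t') * q y"
        using t t' by (intro tilt_le q) auto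
      also have "x + x' + (t + t') *\<^sub>R y = (x + t *\<^sub>R y) + (x' + t' *\<^sub>R y)"
        by (simp add: algebra_simps)
      finally show "tilt q y (x + x') - (q (x + t *\<^sub>R y) - t * q y) \<le> q (x' + t' *\<^sub>R y) - t' * q y"
        using sublinear_add[OF q, of "x + t *\<^sub>R y" "x' + t' *\<^sub>R y"] by (simp add: algebra_simps)
    qed
    then show "tilt q y (x + x') - tilt q y x' \<le> q (x + t *\<^sub>R y) - t * q y" by simp
  qed
  then show "tilt q y (x + x') \<le> tilt q y x + tilt q y x'" by simp
next
  have le: "r * tilt q y x \<le> tilt q y (r *\<^sub>R x)" if "r > 0" for r x
  proof (rule tilt_greatest)
    fix t :: real assume "t \<ge> 0"
    then have "tilt q y x \<le> q (x + (t / r) *\<^sub>R y) - (t / r) * q y" using that by (intro tilt_le q) auto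
    then have "r * tilt q y x \<le> r * (q (x + (t / r) *\<^sub>R y) - (t / r) * q y)"
      using that by (intro mult_left_mono) auto
    also have "\<dots> = q (r *\<^sub>R (x + (t / r) *\<^sub>R y)) - t * q y"
      using that sublinear_scaleR[OF q, of r "x + (t / r) *\<^sub>R y"] by (simp add: algebra_simps)
    finally show "r * tilt q y x \<le> q (r *\<^sub>R x + t *\<^sub>R y) - t * q y"
      using that by (simp add: scaleR_add_right)
  qed
  fix r :: real and x assume "r \<ge> 0"
  show "tilt q y (r *\<^sub>R x) = r * tilt q y x"
  proof (cases "r = 0")
    case True
    have "tilt q y 0 \<le> 0" using tilt_le[OF q, of 0 y 0] sublinear_0[OF q] by simp
    moreover have "0 \<le> tilt q y 0"
      by (rule tilt_greatest) (simp add: sublinear_scaleR[OF q])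
    ultimately show ?thesis using True by simp
  next
    case False
    then have r: "r > 0" using \<open>r \<ge> 0\<close> by simp
    have "inverse r * tilt q y (r *\<^sub>R x) \<le> tilt q y x"
      using le[of "inverse r" "r *\<^sub>R x"] r by simp
    then have "tilt q y (r *\<^sub>R x) \<le> r * tilt q y x" using r by (simp add: field_simps)
    with le[OF r, of x] show ?thesis by simp
  qed
qed

lemma minimal_sublinear_linear:
  assumes q: "sublinear q" and min: "\<And>r. sublinear r \<Longrightarrow> (\<And>x. r x \<le> q x) \<Longrightarrow> r = q"
  shows "linear q"
proof -
  have add: "q (x + y) = q x + q y" for x y
  proof -
    have "tilt q y = q"
      using tilt_le[OF q, of 0 y] by (intro min sublinear_tilt q) simp
    then have "q x \<le> q (x + y) - q y" using tilt_le[OF q, of 1 y x] by simp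
    with sublinear_add[OF q, of x y] show ?thesis by simp
  qed
  have neg: "q (- x) = - q x" for x using add[of x "- x"] sublinear_0[OF q] by simp
  show ?thesis
  proof (rule linearI[OF add])
    fix r :: real and x
    show "q (r *\<^sub>R x) = r *\<^sub>R q x"
    proof (cases "r \<ge> 0")
      case True
      then show ?thesis by (simp add: sublinear_scaleR[OF q])
    next
      case False
      then have "q ((- r) *\<^sub>R x) = (- r) * q x" by (intro sublinear_scaleR[OF q]) auto
      then show ?thesis by (simp add: neg)
    qed
  qed
qed

lemma exists_minimal_sublinear:
  assumes p: "sublinear p"
  obtains q where "sublinear q" "\<And>x. q x \<le> p x" "\<And>r. sublinear r \<Longrightarrow> (\<And>x. r x \<le> q x) \<Longrightarrow> r = q"
proof -
  define A where "A = {q. sublinear q \<and> q \<le> p}"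
  \<comment> \<open>Zorn for maximal elements is applied to the reversed pointwise order. The
    infimum of a chain is finite because each member is at least - p (- x) at x.\<close>
  have "\<exists>m\<in>A. \<forall>a\<in>A. (\<lambda>x y. y \<le> x) m a \<longrightarrow> a = m"
  proof (rule predicate_Zorn)
    show "partial_order_on A (relation_of (\<lambda>x y. y \<le> x) A)"
      by (rule partial_order_on_relation_ofI) auto
  next
    fix C assume "C \<in> Chains (relation_of (\<lambda>x y. y \<le> x) A)"
    then have CA: "C \<subseteq> A" and ch: "\<And>a b. a \<in> C \<Longrightarrow> b \<in> C \<Longrightarrow> a \<le> b \<or> b \<le> a"
      by (auto simp: Chains_def relation_of_def)
    show "\<exists>u\<in>A. \<forall>a\<in>C. u \<le> a"
    proof (cases "C = {}")
      case True
      then show ?thesis using p by (auto simp: A_def)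
    next
      case False
      define u where "u x = (INF q\<in>C. q x)" for x
      have bdd: "bdd_below ((\<lambda>q. q x) ` C)" for x
      proof (rule bdd_belowI2[where m = "- p (- x)"])
        fix q assume "q \<in> C"
        then have "sublinear q" "q (- x) \<le> p (- x)" using CA by (auto simp: A_def le_fun_def)
        with sublinear_minus[of q x] show "- p (- x) \<le> q x" by simp
      qed
      have ule: "u x \<le> q x" if "q \<in> C" for q x unfolding u_def by (rule cINF_lower[OF bdd that])
      have ugr: "m \<le> u x" if "\<And>q. q \<in> C \<Longrightarrow> m \<le> q x" for m x
        unfolding u_def by (rule cINF_greatest[OF False that])
      have sub: "sublinear q" if "q \<in> C" for q using that CA by (auto simp: A_def)
      have "sublinear u" unfolding sublinear_def
      proof (intro conjI allI impI)
        fix x y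
        have "u (x + y) - u y \<le> u x"
        proof (rule ugr)
          fix q assume q: "q \<in> C"
          have "u (x + y) - q x \<le> u y"
          proof (rule ugr)
            fix q' assume q': "q' \<in> C"
            \<comment> \<open>The chain property supplies one member below both q and q'; an infimum
              over an arbitrary set need not be subadditive.\<close>
            obtain s where s: "s \<in> C" "s \<le> q" "s \<le> q'" using ch[OF q q'] q q' by blast
            then have "u (x + y) \<le> s x + s y"
              using ule[OF s(1), of "x + y"] sublinear_add[OF sub[OF s(1)], of x y] by linarith
            also have "\<dots> \<le> q x + q' y" using s by (intro add_mono) (auto simp: le_fun_def)
            finally show "u (x + y) - q x \<le> q' y" by simp
          qed
          then show "u (x + y) - u y \<le> q x" by simp
        qed
        then show "u (x + y) \<le> u x + u y" by simp
      next
        fix r :: real and x assume r: "r \<ge> 0"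
        show "u (r *\<^sub>R x) = r * u x"
        proof (cases "r = 0")
          case True
          obtain q0 where q0: "q0 \<in> C" using False by blast
          then have "u 0 \<le> 0" using ule[OF q0, of 0] sublinear_0[OF sub[OF q0]] by simp
          moreover have "0 \<le> u 0" by (rule ugr) (simp add: sublinear_0[OF sub])
          ultimately show ?thesis using True by simp
        next
          case False
          with r have r: "r > 0" by simp
          have "r * u x \<le> u (r *\<^sub>R x)"
          proof (rule ugr)
            fix q assume q: "q \<in> C"
            show "r * u x \<le> q (r *\<^sub>R x)"
              using ule[OF q, of x] sublinear_scaleR[OF sub[OF q], of r x] r by simp
          qed
          moreover have "u (r *\<^sub>R x) / r \<le> u x"
          proof (rule ugr)
            fix q assume q: "q \<in> C"
            show "u (r *\<^sub>R x) / r \<le> q x"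
              using ule[OF q, of "r *\<^sub>R x"] sublinear_scaleR[OF sub[OF q], of r x] r
              by (simp add: field_simps)
          qed
          ultimately show ?thesis using r by (simp add: field_simps)
        qed
      qed
      moreover have "u \<le> p"
      proof -
        obtain q0 where "q0 \<in> C" using False by blast
        then have "u \<le> q0" "q0 \<le> p" using ule CA by (auto simp: le_fun_def A_def)
        then show ?thesis by simp
      qed
      ultimately show ?thesis using ule by (intro bexI[of _ u]) (auto simp: A_def le_fun_def)
    qed
  qed
  then obtain m where m: "sublinear m" "m \<le> p" "\<And>a. sublinear a \<Longrightarrow> a \<le> p \<Longrightarrow> a \<le> m \<Longrightarrow> a = m"
    by (auto simp: A_def)
  show ?thesis
  proof (rule that[OF m(1)])
    show "m x \<le> p x" for x using m(2) by (simp add: le_fun_def)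
    show "r = m" if "sublinear r" "\<And>x. r x \<le> m x" for r
    proof (rule m(3)[OF that(1)])
      show "r \<le> m" using that(2) by (simp add: le_fun_def)
      then show "r \<le> p" using m(2) by simp
    qed
  qed
qed

text \<open>Minimality is taken below \<open>tilt p s\<close> and not below \<open>p\<close>: the
  tilt with t = 1 gives g (- s) \<le> - p s, and with g \<le> p this forces g s = p s. No functional
  on a line has to be extended.\<close>

lemma sublinear_dominates_linear:
  assumes p: "sublinear p"
  obtains g where "linear g" "\<And>x. g x \<le> p x" "g s = p s"
proof -
  obtain g where g: "sublinear g" "\<And>x. g x \<le> tilt p s x" "\<And>r. sublinear r \<Longrightarrow> (\<And>x. r x \<le> g x) \<Longrightarrow> r = g"
    using exists_minimal_sublinear[OF sublinear_tilt[OF p]] by metis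
  have lin: "linear g" by (rule minimal_sublinear_linear[OF g(1)]) (rule g(3))
  have le: "g x \<le> p x" for x using g(2)[of x] tilt_le[OF p, of 0 s x] by simp
  have "g (- s) \<le> - p s" using g(2)[of "- s"] tilt_le[OF p, of 1 s "- s"] sublinear_0[OF p] by simp
  then have "g s = p s" using le[of s] linear_neg[OF lin, of s] by simp
  then show ?thesis using that[OF lin le] by blast
qed

lemma infdist_subspace:
  fixes V :: "'a::real_normed_vector set"
  assumes V: "subspace V" shows "sublinear (\<lambda>x. infdist x V)"
  unfolding sublinear_def
proof (intro conjI allI impI)
  have V0: "V \<noteq> {}" using subspace_0[OF V] by blast
  have gr: "m \<le> infdist x V" if "\<And>v. v \<in> V \<Longrightarrow> m \<le> dist x v" for m x
    using V0 that by (simp add: infdist_notempty cINF_greatest)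
  fix x y :: 'a
  have "infdist (x + y) V - infdist y V \<le> infdist x V"
  proof (rule gr)
    fix v assume v: "v \<in> V"
    have "infdist (x + y) V - dist x v \<le> infdist y V"
    proof (rule gr)
      fix w assume w: "w \<in> V"
      have "infdist (x + y) V \<le> dist (x + y) (v + w)" by (intro infdist_le subspace_add V v w)
      also have "\<dots> \<le> dist x v + dist y w" by (rule dist_triangle_add)
      finally show "infdist (x + y) V - dist x v \<le> dist y w" by simp
    qed
    then show "infdist (x + y) V - infdist y V \<le> dist x v" by simp
  qed
  then show "infdist (x + y) V \<le> infdist x V + infdist y V" by simp
next
  have V0: "V \<noteq> {}" using subspace_0[OF V] by blast
  have le: "infdist (r *\<^sub>R x) V \<le> r * infdist x V" if r: "r > 0" for r and x :: 'a
  proof -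
    have "infdist (r *\<^sub>R x) V / r \<le> dist x v" if v: "v \<in> V" for v
    proof -
      have "infdist (r *\<^sub>R x) V \<le> dist (r *\<^sub>R x) (r *\<^sub>R v)" by (intro infdist_le subspace_scale V v)
      also have "\<dots> = r * dist x v" using r by (simp add: dist_norm flip: scaleR_diff_right)
      finally show ?thesis using r by (simp add: field_simps)
    qed
    then have "infdist (r *\<^sub>R x) V / r \<le> infdist x V"
      using V0 by (simp add: infdist_notempty[of V x] cINF_greatest)
    then show ?thesis using r by (simp add: field_simps)
  qed
  fix r :: real and x :: 'a assume "r \<ge> 0"
  show "infdist (r *\<^sub>R x) V = r * infdist x V"
  proof (cases "r = 0")
    case True
    then show ?thesis using subspace_0[OF V] by simp
  next
    case False
    then have r: "r > 0" using \<open>r \<ge> 0\<close> by simp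
    have "infdist x V \<le> inverse r * infdist (r *\<^sub>R x) V"
      using le[of "inverse r" "r *\<^sub>R x"] r by simp
    then have "r * infdist x V \<le> infdist (r *\<^sub>R x) V" using r by (simp add: field_simps)
    with le[OF r, of x] show ?thesis by simp
  qed
qed

text \<open>The distance to V vanishes on V, is positive at s and is at most the norm. A linear
  functional below it, exact at s, is therefore bounded, zero on V and nonzero at s.\<close>

lemma separate_subspace:
  fixes V :: "'a::real_normed_vector set"
  assumes V: "subspace V" and s: "s \<notin> closure V"
  obtains g :: "'a \<Rightarrow> real" where "bounded_linear g" "\<And>v. v \<in> V \<Longrightarrow> g v = 0" "g s \<noteq> 0"
proof -
  obtain g where g: "linear g" "\<And>x. g x \<le> infdist x V" "g s = infdist s V"
    using sublinear_dominates_linear[OF infdist_subspace[OF V]] by blast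
  have le: "g x \<le> norm x" for x
    using g(2)[of x] infdist_le[OF subspace_0[OF V], of x] by (simp add: dist_norm)
  have "\<bar>g x\<bar> \<le> norm x" for x
    using le[of x] le[of "- x"] linear_neg[OF g(1), of x] by simp
  then have "bounded_linear g"
    by (intro bounded_linear_intro[where K = 1]) (auto simp: linear_add[OF g(1)] linear_scale[OF g(1)])
  moreover have "g v = 0" if v: "v \<in> V" for v
    using g(2)[of v] g(2)[of "- v"] linear_neg[OF g(1), of v] v subspace_neg[OF V v] by simp
  moreover have "g s \<noteq> 0"
    using s subspace_0[OF V] unfolding g(3) by (metis empty_iff in_closure_iff_infdist_zero)
  ultimately show ?thesis using that by blast
qed

section \<open>Complex functionals and separation\<close>

lemma scaleC_i_twice: "\<i> *\<^sub>C \<i> *\<^sub>C x = - (x :: 'a::cstar_algebra)"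
proof -
  have "\<i> *\<^sub>C \<i> *\<^sub>C x = complex_of_real (- 1) *\<^sub>C x" by (simp add: scaleC_scaleC)
  then show ?thesis by (metis scaleR_scaleC scaleR_minus1_left)
qed

text \<open>The usual complexification g(x) - i g(ix), whose real part is g.\<close>

lemma dual_space_of_real_functional:
  fixes g :: "'a::cstar_algebra \<Rightarrow> real"
  assumes g: "bounded_linear g"
  shows "(\<lambda>x. Complex (g x) (- g (\<i> *\<^sub>C x))) \<in> dual_space" (is "?f \<in> _")
proof -
  interpret bounded_linear g by (rule g)
  obtain K where K: "K > 0" "\<And>x. norm (g x) \<le> norm x * K" using pos_bounded by blast
  have split: "z *\<^sub>C x = Re z *\<^sub>R x + Im z *\<^sub>R (\<i> *\<^sub>C x)" for z and x :: 'a
  proof -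
    have "complex_of_real (Re z) + complex_of_real (Im z) * \<i> = z" by (simp add: complex_eq_iff)
    then show ?thesis by (metis scaleC_add_left scaleC_scaleC scaleR_scaleC)
  qed
  have fC: "?f (z *\<^sub>C x) = z * ?f x" for z x
  proof -
    have "\<i> *\<^sub>C z *\<^sub>C x = z *\<^sub>C \<i> *\<^sub>C x" by (simp add: scaleC_scaleC mult.commute)
    also have "\<dots> = Re z *\<^sub>R (\<i> *\<^sub>C x) - Im z *\<^sub>R x"
      by (subst split) (simp add: scaleC_i_twice)
    finally have "g (\<i> *\<^sub>C z *\<^sub>C x) = Re z * g (\<i> *\<^sub>C x) - Im z * g x" by (simp add: diff scaleR)
    moreover have "g (z *\<^sub>C x) = Re z * g x + Im z * g (\<i> *\<^sub>C x)"
      by (subst split) (simp add: add scaleR)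
    ultimately show ?thesis by (simp add: complex_eq_iff)
  qed
  moreover have "bounded_linear ?f"
  proof (rule bounded_linear_intro[where K = "K + K"])
    show "?f (x + y) = ?f x + ?f y" for x y by (simp add: complex_eq_iff scaleC_add_right add)
    show "?f (r *\<^sub>R x) = r *\<^sub>R ?f x" for r x
      unfolding scaleR_scaleC[of r x] fC by (simp add: scaleR_conv_of_real)
    show "norm (?f x) \<le> norm x * (K + K)" for x
    proof -
      have "norm (?f x) \<le> \<bar>g x\<bar> + \<bar>g (\<i> *\<^sub>C x)\<bar>" using cmod_le[of "?f x"] by simp
      also have "\<dots> \<le> norm x * K + norm (\<i> *\<^sub>C x) * K"
        using K(2)[of x] K(2)[of "\<i> *\<^sub>C x"] by (intro add_mono) auto
      finally show ?thesis by (simp add: norm_scaleC algebra_simps)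
    qed
  qed
  ultimately show ?thesis by (simp add: dual_space_def)
qed

text \<open>V is a real subspace only, so it is the real part of f that vanishes on it.\<close>

lemma dual_space_separates_subspace:
  fixes V :: "'a::cstar_algebra set"
  assumes "subspace V" "s \<notin> closure V"
  obtains f where "f \<in> dual_space" "\<And>v. v \<in> V \<Longrightarrow> Re (f v) = 0" "Re (f s) \<noteq> 0"
proof -
  obtain g :: "'a \<Rightarrow> real" where g: "bounded_linear g" "\<And>v. v \<in> V \<Longrightarrow> g v = 0" "g s \<noteq> 0"
    using separate_subspace[OF assms] by blast
  show ?thesis by (rule that[OF dual_space_of_real_functional[OF g(1)]]) (use g in auto)
qed

lemma dual_space_separates_points:
  fixes x y :: "'a::cstar_algebra"
  assumes "\<And>f. f \<in> dual_space \<Longrightarrow> f x = f y" shows "x = y"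
proof (rule ccontr)
  assume "x \<noteq> y"
  then have "x - y \<notin> closure {0}" by simp
  then obtain f where f: "f \<in> dual_space" "Re (f (x - y)) \<noteq> 0"
    using dual_space_separates_subspace[OF subspace_single_0, of "x - y"] by metis
  then have "bounded_linear f" by (simp add: dual_space_def)
  then have "f (x - y) = f x - f y" by (intro linear_diff bounded_linear.linear)
  with f(2) assms[OF f(1)] show False by simp
qed

section \<open>The weak topology and its cluster points\<close>

lemma topspace_weak_topology [simp]: "topspace (weak_topology :: 'a::cstar_algebra topology) = UNIV"
proof -
  have "(\<lambda>_::'a. 0) \<in> dual_space" by (simp add: dual_space_def bounded_linear_zero)
  then have "(\<lambda>_::'a. 0::complex) -` UNIV \<in> {f -` U |f U. f \<in> dual_space \<and> open U}" by blast
  then show ?thesis unfolding weak_topology_def topology_generated_by_topspace by auto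
qed

lemma openin_weak_topology:
  "f \<in> dual_space \<Longrightarrow> open U \<Longrightarrow> openin (weak_topology :: 'a::cstar_algebra topology) (f -` U)"
  unfolding weak_topology_def by (rule topology_generated_by_Basis) blast

lemma compact_imp_compactin_weak:
  fixes K :: "'a::cstar_algebra set"
  assumes "compact K" shows "compactin weak_topology K"
proof -
  have "continuous_map euclidean weak_topology (\<lambda>x::'a. x)"
    unfolding weak_topology_def
  proof (rule continuous_on_generated_topo)
    fix S :: "'a set" assume "S \<in> {f -` U |f U. f \<in> dual_space \<and> open U}"
    then obtain f :: "'a \<Rightarrow> complex" and U where "S = f -` U" "bounded_linear f" "open U" unfolding dual_space_def by blast
    then have "open S" using continuous_open_vimage linear_continuous_at by blast
    then show "openin euclidean ((\<lambda>x. x) -` S \<inter> topspace euclidean)" by simp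
  next
    show "(\<lambda>x::'a. x) ` topspace euclidean \<subseteq> \<Union> {f -` U |f U. f \<in> dual_space \<and> open U}"
      using topspace_weak_topology[where 'a = 'a]
      unfolding weak_topology_def topology_generated_by_topspace by auto
  qed
  from image_compactin[OF _ this, of K] assms show ?thesis by simp
qed

text \<open>The weak topology need not be metrizable, so a cluster point replaces the limit of a
  subsequence.\<close>

lemma compactin_cluster_point:
  assumes K: "compactin X K" and s: "\<And>n::nat. s n \<in> K"
  obtains q where "q \<in> K" "\<And>U N. openin X U \<Longrightarrow> q \<in> U \<Longrightarrow> \<exists>n\<ge>N. s n \<in> U"
proof -
  have "\<exists>q\<in>K. \<forall>U N. openin X U \<longrightarrow> q \<in> U \<longrightarrow> (\<exists>n\<ge>N. s n \<in> U)"
  proof (rule ccontr)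
    assume "\<not> ?thesis"
    then have "\<forall>q\<in>K. \<exists>U N. openin X U \<and> q \<in> U \<and> (\<forall>n\<ge>N. s n \<notin> U)" by simp
    from bchoice[OF this] obtain U
      where "\<forall>q\<in>K. \<exists>N. openin X (U q) \<and> q \<in> U q \<and> (\<forall>n\<ge>N. s n \<notin> U q)" ..
    from bchoice[OF this] obtain N
      where UN: "\<forall>q\<in>K. openin X (U q) \<and> q \<in> U q \<and> (\<forall>n\<ge>N q. s n \<notin> U q)" ..
    have "\<exists>F. finite F \<and> F \<subseteq> U ` K \<and> K \<subseteq> \<Union> F"
    proof (rule compactinD[OF K])
      show "openin X V" if "V \<in> U ` K" for V using UN that by blast
      show "K \<subseteq> \<Union> (U ` K)" using UN by blast
    qed
    then obtain Q where Q: "finite Q" "Q \<subseteq> K" "K \<subseteq> \<Union> (U ` Q)"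
      by (metis finite_subset_image)
    obtain m where m: "\<And>q. q \<in> Q \<Longrightarrow> N q \<le> m"
      using Q(1) by (metis finite_nat_set_iff_bounded_le finite_imageI imageI)
    obtain q where "q \<in> Q" "s m \<in> U q" using Q(3) s by blast
    then show False using UN m Q(2) by blast
  qed
  then show ?thesis using that by blast
qed

lemma cluster_functional_closed:
  fixes q :: "'a::cstar_algebra"
  assumes q: "\<And>U N :: nat. openin weak_topology U \<Longrightarrow> q \<in> U \<Longrightarrow> \<exists>n\<ge>N. s n \<in> U"
    and f: "f \<in> dual_space" and C: "closed C" "\<And>n::nat. n \<ge> N \<Longrightarrow> f (s n) \<in> C"
  shows "f q \<in> C"
proof (rule ccontr)
  assume "f q \<notin> C"
  then obtain n where "n \<ge> N" "f (s n) \<notin> C"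
    using q[OF openin_weak_topology[OF f, of "- C"], of N] C(1) by auto
  with C(2) show False by blast
qed

lemma cluster_functional_limit:
  fixes q :: "'a::cstar_algebra"
  assumes q: "\<And>U N :: nat. openin weak_topology U \<Longrightarrow> q \<in> U \<Longrightarrow> \<exists>n\<ge>N. s n \<in> U"
    and f: "f \<in> dual_space" and lim: "(\<lambda>n::nat. f (s n)) \<longlonglongrightarrow> l"
  shows "f q = l"
proof -
  have "dist (f q) l \<le> e" if "e > 0" for e
  proof -
    obtain N where N: "\<And>n. n \<ge> N \<Longrightarrow> dist (f (s n)) l < e"
      using lim \<open>e > 0\<close> unfolding lim_sequentially by blast
    have "f q \<in> cball l e"
      by (rule cluster_functional_closed[OF q f closed_cball, where N = N])
        (use N in \<open>auto simp: dist_commute less_imp_le\<close>)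
    then show ?thesis by (simp add: dist_commute)
  qed
  then have "dist (f q) l \<le> 0" by (rule field_le_epsilon) simp
  then show ?thesis by simp
qed

subsection \<open>From a compact algebra to compact order intervals\<close>

lemma relatively_compact_subset:
  "relatively_compact T \<Longrightarrow> S \<subseteq> T \<Longrightarrow> relatively_compact (S :: 'a::t2_space set)"
  unfolding relatively_compact_def
  by (metis closed_closure closure_mono compact_Int_closed inf.absorb_iff2)

lemma relatively_compact_if_subset_compact:
  "compact K \<Longrightarrow> S \<subseteq> K \<Longrightarrow> relatively_compact (S :: 'a::t2_space set)"
  by (rule relatively_compact_subset[of K]) (simp_all add: relatively_compact_def compact_imp_closed)

lemma relatively_compact_image:
  fixes f :: "'a::t2_space \<Rightarrow> 'b::t2_space"
  assumes "relatively_compact T" "continuous_on UNIV f"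
  shows "relatively_compact (f ` T)"
proof (rule relatively_compact_if_subset_compact)
  show "compact (f ` closure T)"
    using assms by (intro compact_continuous_image) (auto simp: relatively_compact_def intro: continuous_on_subset)
  show "f ` T \<subseteq> f ` closure T" by (intro image_mono closure_subset)
qed

lemma relatively_compact_finite_net:
  fixes T :: "'a::metric_space set"
  assumes "relatively_compact T" "e > 0"
  obtains k where "finite k" "k \<subseteq> closure T" "T \<subseteq> (\<Union>x\<in>k. ball x e)"
proof -
  have "seq_compact (closure T)"
    using assms(1) by (simp add: relatively_compact_def compact_imp_seq_compact)
  then obtain k where "finite k" "k \<subseteq> closure T" "closure T \<subseteq> (\<Union>x\<in>k. ball x e)"
    using seq_compact_imp_totally_bounded[of "closure T"] assms(2) by blast
  then show ?thesis using closure_subset[of T] by (intro that[of k]) auto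
qed

text \<open>Total boundedness survives uniform approximation; this expresses that norm limits of
  compact maps are compact.\<close>

lemma relatively_compact_approx:
  fixes S :: "'a::complete_space set"
  assumes approx: "\<And>e. e > 0 \<Longrightarrow> \<exists>T. relatively_compact T \<and> (\<forall>x\<in>S. \<exists>y\<in>T. dist x y < e)"
  shows "relatively_compact S"
  unfolding relatively_compact_def compact_eq_totally_bounded
proof (intro conjI allI impI)
  show "complete (closure S)" by (simp add: complete_eq_closed)
  fix e :: real assume e: "e > 0"
  then obtain T where T: "relatively_compact T" "\<And>x. x \<in> S \<Longrightarrow> \<exists>y\<in>T. dist x y < e / 3"
    using approx[of "e / 3"] by auto
  have "e / 3 > 0" using e by simp
  then obtain k where k: "finite k" "k \<subseteq> closure T" "T \<subseteq> (\<Union>x\<in>k. ball x (e / 3))"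
    by (rule relatively_compact_finite_net[OF T(1)])
  have "closure S \<subseteq> (\<Union>x\<in>k. ball x e)"
  proof
    fix x assume "x \<in> closure S"
    then obtain x' where x': "x' \<in> S" "dist x' x < e / 3"
      using e unfolding closure_approachable by (meson divide_pos_pos zero_less_numeral)
    obtain y where y: "y \<in> T" "dist x' y < e / 3" using T(2)[OF x'(1)] by blast
    obtain z where z: "z \<in> k" "dist z y < e / 3" using k(3) y(1) by auto
    have "dist z x < e" using x'(2) y(2) z(2) dist_triangle[of z x y] dist_triangle[of y x x']
      by (simp add: dist_commute)
    with z(1) show "x \<in> (\<Union>x\<in>k. ball x e)" by auto
  qed
  with k(1) show "\<exists>k. finite k \<and> closure S \<subseteq> (\<Union>x\<in>k. ball x e)" by blast
qed

lemma order_interval_iff: "y \<in> order_interval_from_0 c \<longleftrightarrow> psd y \<and> psd (c - y)"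
  by (simp add: order_interval_from_0_def cstar_le_def positive_cone_iff)

lemma PSol_iff: "x \<in> PSol M \<longleftrightarrow> psd x \<and> (\<exists>y\<in>M. psd (y - x))"
  by (auto simp: PSol_def cstar_le_def positive_cone_iff)

lemma closed_order_interval: "closed (order_interval_from_0 (c :: 'a::cstar_algebra))"
proof -
  have "order_interval_from_0 c = {y. psd y} \<inter> (\<lambda>y. c - y) -` {y. psd y}"
    by (auto simp: order_interval_iff)
  moreover have "closed ((\<lambda>y. c - y) -` {y. psd y})"
    by (intro continuous_closed_vimage closed_psd continuous_intros)
  ultimately show ?thesis using closed_psd by (metis closed_Int)
qed

lemma psd_sum: "(\<And>x. x \<in> A \<Longrightarrow> psd (f x)) \<Longrightarrow> psd (sum f A :: 'a::cstar_algebra)"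
  by (induction A rule: infinite_finite_induct) (auto intro: psd_add)

lemma norm_one_minus_emb_le: "norm e \<le> 1 \<Longrightarrow> norm (1 - emb e) \<le> 2"
  using norm_triangle_ineq4[of 1 "emb e"] by simp

lemma compact_algebra_imp_relatively_compact_PSol:
  fixes M :: "'a::cstar_algebra set"
  assumes S1: "compact_algebra TYPE('a)" and Mpos: "M \<subseteq> positive_cone" and M: "relatively_compact M"
  shows "relatively_compact (PSol M)"
proof (rule relatively_compact_approx)
  fix \<epsilon> :: real assume \<epsilon>: "\<epsilon> > 0"
  have Mpsd: "closure M \<subseteq> {x. psd x}"
    using Mpos by (intro closure_minimal closed_psd) (auto simp: positive_cone_iff)
  have "bounded (closure M)" using M by (simp add: relatively_compact_def compact_imp_bounded)
  then obtain R where R: "R > 0" "\<And>y. y \<in> M \<Longrightarrow> norm y \<le> R"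
    using closure_subset[of M] unfolding bounded_pos by blast
  \<comment> \<open>Chosen from the end: E c E costs 2\<eta> and replacing y by its net point
    4\<eta>, so (norm (x E))^2 \<le> 6 R \<eta> = \<epsilon>^2/8, and the two pieces of x - e x e
    stay below \<epsilon> together.\<close>
  define \<eta> where "\<eta> = \<epsilon>\<^sup>2 / (48 * R)"
  have \<eta>: "\<eta> > 0" using \<epsilon> R by (simp add: \<eta>_def)
  obtain k where k: "finite k" "k \<subseteq> closure M" "M \<subseteq> (\<Union>x\<in>k. ball x \<eta>)"
    using relatively_compact_finite_net[OF M \<eta>] .
  \<comment> \<open>The sum of the finite net dominates each of its points, so a single e serves all
    y in M.\<close>
  define c where "c = \<Sum>k"
  have kpsd: "psd y" if "y \<in> k" for y using k(2) Mpsd that by auto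
  have c: "psd c" unfolding c_def by (rule psd_sum[OF kpsd])
  obtain e where e: "psd e" "norm e \<le> 1" "norm (c - e * c) \<le> \<eta>"
    using approximate_unit[OF c \<eta>] by blast
  have se: "star e = e" by (rule psd_self_adjoint[OF e(1)])
  define E where "E = 1 - emb e"
  have sE: "star E = E" by (simp add: E_def star_diff se flip: emb_star)
  have nE: "norm E \<le> 2" unfolding E_def by (rule norm_one_minus_emb_le[OF e(2)])
  have Ec: "E * emb c = emb (c - e * c)" by (simp add: E_def emb_simps algebra_simps)
  have "norm (E * emb c * E) \<le> norm (E * emb c) * norm E" by (rule norm_mult_ineq)
  also have "\<dots> \<le> \<eta> * 2" unfolding Ec using e(3) nE \<eta> by (intro mult_mono) auto
  finally have EcE: "norm (E * emb c * E) \<le> 2 * \<eta>" by simp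
  have key: "norm (x - e * x * e) < \<epsilon> \<and> norm x \<le> R" if xM: "x \<in> PSol M" for x
  proof -
    obtain y where x: "psd x" and y: "y \<in> M" "psd (y - x)" using xM unfolding PSol_iff by blast
    have nx: "norm x \<le> R" using psd_norm_mono[OF x y(2)] R(2)[OF y(1)] by linarith
    obtain z where z: "z \<in> k" "dist z y < \<eta>" using k(3) y(1) by auto
    have "c - z = \<Sum>(k - {z})" using z(1) k(1) by (simp add: c_def sum_diff1)
    then have cz: "psd (c - z)" using psd_sum[of "k - {z}" "\<lambda>x. x"] kpsd by auto
    have "norm (star E * emb z * E) \<le> norm (star E * emb c * E)"
    proof (rule psd_norm_mono_unital)
      show "psd (star E * emb z * E)" using kpsd[OF z(1)] by (intro psd_conj) simp
      have "psd (star E * emb (c - z) * E)" using cz by (intro psd_conj) simp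
      then show "psd (star E * emb c * E - star E * emb z * E)" by (simp add: emb_diff algebra_simps)
    qed
    then have EzE: "norm (E * emb z * E) \<le> 2 * \<eta>" using EcE by (simp add: sE)
    have "norm (E * emb (y - z) * E) \<le> norm E * norm (y - z) * norm E"
      using order_trans[OF norm_mult_ineq mult_right_mono[OF norm_mult_ineq norm_ge_zero], of E "emb (y - z)" E]
      by simp
    also have "\<dots> \<le> 2 * \<eta> * 2"
      using nE z(2) \<eta> by (intro mult_mono) (auto simp: dist_norm norm_minus_commute)
    finally have "norm (E * emb (y - z) * E) \<le> 4 * \<eta>" by simp
    moreover have "E * emb y * E = E * emb (y - z) * E + E * emb z * E"
      by (simp add: emb_diff algebra_simps)
    ultimately have EyE: "norm (E * emb y * E) \<le> 6 * \<eta>"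
      using norm_triangle_ineq[of "E * emb (y - z) * E" "E * emb z * E"] EzE by simp
    have "(norm (emb x * E))\<^sup>2 \<le> norm (emb x) * norm (star E * emb y * E)"
      by (rule norm_mult_square_le) (use x y(2) in \<open>simp_all flip: emb_diff\<close>)
    also have "\<dots> \<le> R * (6 * \<eta>)" using nx EyE R(1) by (intro mult_mono) (auto simp: sE)
    also have "\<dots> = \<epsilon>\<^sup>2 / 8" using R(1) by (simp add: \<eta>_def)
    finally have "(norm (emb x * E))\<^sup>2 \<le> \<epsilon>\<^sup>2 / 8" .
    moreover have "(2 * norm (emb x * E))\<^sup>2 = 4 * (norm (emb x * E))\<^sup>2" by (simp add: power_mult_distrib)
    ultimately have "(2 * norm (emb x * E))\<^sup>2 < \<epsilon>\<^sup>2"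
      using zero_less_power[OF \<epsilon>, of 2] by linarith
    then have 1: "2 * norm (emb x * E) < \<epsilon>" by (rule power_less_imp_less_base) (use \<epsilon> in simp)
    have xE: "emb x * E = emb (x - x * e)" by (simp add: E_def emb_simps algebra_simps)
    \<comment> \<open>The two pieces of x - e x e are controlled by adjoint elements, so one
      estimate covers both.\<close>
    have "star (x - x * e) = x - e * x" by (simp add: star_diff star_mult se psd_self_adjoint[OF x])
    then have 2: "norm (x - e * x) = norm (x - x * e)" by (metis norm_star)
    have eq: "x - e * x * e = (x - x * e) + (x - e * x) * e" by (simp add: algebra_simps)
    have "norm (x - e * x * e) \<le> norm (x - x * e) + norm (x - e * x) * norm e"
      unfolding eq by (rule order_trans[OF norm_triangle_ineq add_left_mono[OF norm_mult_ineq]])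
    also have "\<dots> \<le> norm (x - x * e) + norm (x - e * x) * 1"
      by (intro add_left_mono mult_left_mono e) auto
    finally show ?thesis using 1 nx by (simp add: xE 2)
  qed
  have "relatively_compact ((\<lambda>b. e * b * e) ` cball 0 R)"
    using S1 by (auto simp: compact_algebra_def multiplication_compact_def compact_operator_def)
  moreover have "\<exists>y\<in>(\<lambda>b. e * b * e) ` cball 0 R. dist x y < \<epsilon>" if "x \<in> PSol M" for x
    using key[OF that] by (intro bexI[of _ "e * x * e"]) (auto simp: dist_norm)
  ultimately show "\<exists>T. relatively_compact T \<and> (\<forall>x\<in>PSol M. \<exists>y\<in>T. dist x y < \<epsilon>)" by blast
qed

lemma relatively_compact_PSol_imp_compact_interval:
  fixes c :: "'a::cstar_algebra"
  assumes "\<forall>M\<subseteq>(positive_cone :: 'a set). relatively_compact M \<longrightarrow> relatively_compact (PSol M)"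
    and "c \<in> positive_cone"
  shows "compact (order_interval_from_0 c)"
proof -
  have "relatively_compact (PSol {c})"
    using assms by (auto simp: relatively_compact_def)
  moreover have "PSol {c} = order_interval_from_0 c"
    by (auto simp: PSol_iff order_interval_iff)
  ultimately show ?thesis by (simp add: relatively_compact_def closed_order_interval)
qed

subsection \<open>From weakly compact order intervals to a compact algebra\<close>

definition weakly_compact_intervals :: "'a::cstar_algebra itself \<Rightarrow> bool"
  where "weakly_compact_intervals _ \<longleftrightarrow>
    (\<forall>c::'a. psd c \<longrightarrow> compactin weak_topology (order_interval_from_0 c))"

lemma dual_space_mult_right:
  assumes f: "f \<in> dual_space" shows "(\<lambda>x. f (x * a)) \<in> dual_space"
proof -
  have "bounded_linear (f \<circ> (\<lambda>x. x * a))"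
    using f by (intro bounded_linear_compose[unfolded o_def[symmetric]] bounded_linear_mult_left)
      (auto simp: dual_space_def)
  then show ?thesis using f by (simp add: dual_space_def o_def mult_scaleC_left)
qed

text \<open>Two kinds of information reach the cluster point q. A functional whose real part
  vanishes on all s n does so at q, hence q is in the norm-closed span. And since f (x a) is a
  functional of x, a norm limit of s n * a determines q * a.\<close>

lemma weak_limit:
  fixes c :: "'a::cstar_algebra"
  assumes W: "weakly_compact_intervals TYPE('a)" and c: "psd c"
    and s: "\<And>n::nat. psd (s n)" "\<And>n. psd (c - s n)"
  obtains q where "psd q" "psd (c - q)" "q \<in> closure (span (range s))"
    "\<And>a b. (\<lambda>n. s n * a) \<longlonglongrightarrow> b \<Longrightarrow> q * a = b"
proof -
  have "compactin weak_topology (order_interval_from_0 c)"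
    using W c by (simp add: weakly_compact_intervals_def)
  then obtain q where q: "q \<in> order_interval_from_0 c"
    "\<And>U N. openin weak_topology U \<Longrightarrow> q \<in> U \<Longrightarrow> \<exists>n\<ge>N. s n \<in> U"
    by (rule compactin_cluster_point[of _ _ s]) (auto simp: order_interval_iff s)
  have "q \<in> closure (span (range s))"
  proof (rule ccontr)
    assume "q \<notin> closure (span (range s))"
    then obtain f where f: "f \<in> dual_space" "\<And>v. v \<in> span (range s) \<Longrightarrow> Re (f v) = 0" "Re (f q) \<noteq> 0"
      using dual_space_separates_subspace[OF subspace_span] by blast
    have "f q \<in> {z. Re z = 0}"
    proof (rule cluster_functional_closed[OF q(2) f(1)])
      show "closed {z. Re z = 0}" by (intro closed_Collect_eq continuous_intros)
      show "f (s n) \<in> {z. Re z = 0}" if "n \<ge> 0" for n using f(2)[of "s n"] by (simp add: span_base)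
    qed
    with f(3) show False by simp
  qed
  moreover have "q * a = b" if lim: "(\<lambda>n. s n * a) \<longlonglongrightarrow> b" for a b
  proof (rule dual_space_separates_points)
    fix f :: "'a \<Rightarrow> complex" assume f: "f \<in> dual_space"
    then have "bounded_linear f" by (simp add: dual_space_def)
    then have "(\<lambda>n. f (s n * a)) \<longlonglongrightarrow> f b" using lim by (rule bounded_linear.tendsto)
    with cluster_functional_limit[OF q(2) dual_space_mult_right[OF f]] show "f (q * a) = f b"
      by blast
  qed
  ultimately show ?thesis using q(1) that by (auto simp: order_interval_iff)
qed

section \<open>Support projections and descending chains\<close>

definition projection :: "'a::cstar_algebra \<Rightarrow> bool"
  where "projection p \<longleftrightarrow> star p = p \<and> p * p = p"

lemma projection_psd: "projection p \<Longrightarrow> psd p"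
  unfolding projection_def psd_def by metis

lemma projection_norm_le: "projection p \<Longrightarrow> norm p \<le> 1"
  using norm_self_adjoint_square[of p] unfolding projection_def
  by (cases "p = 0") (auto simp: power2_eq_square)

lemma projection_diff:
  assumes "projection p" "projection q" "p * q = q"
  shows "projection (p - q)" "p * (p - q) = p - q" "q * p = q"
proof -
  show qp: "q * p = q" using arg_cong[OF assms(3), of star] assms(1,2) by (simp add: star_mult projection_def)
  show "projection (p - q)" "p * (p - q) = p - q"
    using assms by (simp_all add: projection_def star_diff algebra_simps qp)
qed

text \<open>Carries linear identities from all s n to the cluster point of
  \<open>weak_limit\<close>.\<close>

lemma bounded_linear_zero_on_closure_span:
  fixes f :: "'a::real_normed_vector \<Rightarrow> 'b::real_normed_vector"
  assumes "bounded_linear f" "\<And>n. f (s n) = 0" "t \<in> closure (span (range s))"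
  shows "f t = 0"
proof -
  interpret bounded_linear f by fact
  have "span (range s) \<subseteq> {t. f t = 0}"
    using assms(2) by (intro span_minimal) (auto simp: subspace_def zero add scaleR)
  then have "closure (span (range s)) \<subseteq> {t. f t = 0}"
    by (intro closure_minimal closed_Collect_eq linear_continuous_on assms continuous_intros)
  with assms(3) show ?thesis by blast
qed

lemma bounded_linear_fixed_on_closure_span:
  fixes f :: "'a::real_normed_vector \<Rightarrow> 'a"
  assumes "bounded_linear f" "\<And>n. f (s n) = s n" "t \<in> closure (span (range s))"
  shows "f t = t"
  using bounded_linear_zero_on_closure_span[OF bounded_linear_sub[OF assms(1) bounded_linear_ident] _ assms(3)]
    assms(2) by simp

text \<open>The hypothesis \<open>bound\<close> keeps all resolvents e n of u in the interval from 0
  to c, where a cluster point q exists. The norm limit of e n * u is u, so q u = u; the remaining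
  properties hold for every e n and are linear.\<close>

lemma support_projection:
  fixes c u :: "'a::cstar_algebra"
  assumes W: "weakly_compact_intervals TYPE('a)" and c: "psd c" and u: "psd u"
    and bound: "\<And>e. psd e \<Longrightarrow> psd (1 - emb e) \<Longrightarrow> (\<forall>v. emb u * v = 0 \<longrightarrow> emb e * v = 0) \<Longrightarrow>
      (\<forall>q. q * u = u \<longrightarrow> q * e = e) \<Longrightarrow> psd (c - e)"
  obtains q where "projection q" "q * u = u" "u * q = u"
    "\<And>v. u * v = 0 \<Longrightarrow> q * v = 0" "\<And>p. p * u = u \<Longrightarrow> p * q = q"
proof -
  have "\<forall>n. \<exists>e. psd e \<and> psd (1 - emb e) \<and> norm e \<le> 1 \<and> norm (u - e * u) \<le> 1 / real (Suc n) \<and>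
    (\<forall>v. emb u * v = 0 \<longrightarrow> emb e * v = 0) \<and> (\<forall>q. q * u = u \<longrightarrow> q * e = e)"
    using approximate_unit[OF u] by simp
  from choice[OF this] obtain e where "\<forall>n. psd (e n) \<and> psd (1 - emb (e n)) \<and> norm (e n) \<le> 1 \<and>
    norm (u - e n * u) \<le> 1 / real (Suc n) \<and> (\<forall>v. emb u * v = 0 \<longrightarrow> emb (e n) * v = 0) \<and>
    (\<forall>q. q * u = u \<longrightarrow> q * e n = e n)" ..
  then have e: "\<And>n. psd (e n)" "\<And>n. psd (1 - emb (e n))"
    "\<And>n. norm (u - e n * u) \<le> 1 / real (Suc n)"
    "\<And>n. \<forall>v. emb u * v = 0 \<longrightarrow> emb (e n) * v = 0" "\<And>n. \<forall>q. q * u = u \<longrightarrow> q * e n = e n"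
    by blast+
  obtain q where q: "psd q" "q \<in> closure (span (range e))"
    "\<And>a b. (\<lambda>n. e n * a) \<longlonglongrightarrow> b \<Longrightarrow> q * a = b"
    by (rule weak_limit[OF W c, of e]) (use e bound in blast)+
  have "(\<lambda>n. u - e n * u) \<longlonglongrightarrow> 0"
    by (rule Lim_null_comparison[OF _ LIMSEQ_inverse_real_of_nat])
      (use e(3) in \<open>simp add: inverse_eq_divide\<close>)
  then have "(\<lambda>n. u - (u - e n * u)) \<longlonglongrightarrow> u - 0" by (intro tendsto_intros)
  then have qu: "q * u = u" by (intro q(3)) simp
  have sq: "star q = q" by (rule psd_self_adjoint[OF q(1)])
  have fix': "p * q = q" if "p * u = u" for p
    by (rule bounded_linear_fixed_on_closure_span[OF bounded_linear_mult_right _ q(2)]) (use e(5) that in blast)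
  \<comment> \<open>q is itself a left unit of u, so it fixes q: this is idempotence.\<close>
  have "projection q" using fix'[OF qu] sq by (simp add: projection_def)
  moreover have "u * q = u" using arg_cong[OF qu, of star] by (simp add: star_mult sq psd_self_adjoint[OF u])
  moreover have "q * v = 0" if v: "u * v = 0" for v
  proof (rule bounded_linear_zero_on_closure_span[OF bounded_linear_mult_left _ q(2)])
    fix n
    have "emb u * emb v = 0" using v by (simp flip: emb_mult)
    then have "emb (e n) * emb v = 0" using e(4) by blast
    then show "e n * v = 0" by (simp flip: emb_mult)
  qed
  ultimately show ?thesis using qu fix' that by blast
qed

text \<open>Elements e supported on the cut satisfy \<delta> e \<le> c, so c/\<delta> is the bound
  for the resolvents. The factor 2 is 1 + norm q at its largest.\<close>

lemma spectral_projection: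
  fixes c :: "'a::cstar_algebra"
  assumes W: "weakly_compact_intervals TYPE('a)" and c: "psd c" and d: "\<delta> > 0"
  obtains q where "projection q" "norm (c - c * q) \<le> 2 * \<delta>"
proof -
  obtain u where u: "psd u"
    "\<And>e. psd e \<Longrightarrow> psd (1 - emb e) \<Longrightarrow> (\<forall>v. emb u * v = 0 \<longrightarrow> emb e * v = 0) \<Longrightarrow> psd (c - \<delta> *\<^sub>R e)"
    "\<And>q. u * q = u \<Longrightarrow> norm (c - c * q) \<le> \<delta> * (1 + norm q)"
    using spectral_cut[OF c d] by blast
  have "psd ((1 / \<delta>) *\<^sub>R c)" using c d by (intro psd_scaleR) auto
  then obtain q where q: "projection q" "u * q = u"
  proof (rule support_projection[OF W _ u(1)])
    fix e assume "psd e" "psd (1 - emb e)" "\<forall>v. emb u * v = 0 \<longrightarrow> emb e * v = 0"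
    then have "psd ((1 / \<delta>) *\<^sub>R (c - \<delta> *\<^sub>R e))" using d by (intro psd_scaleR u(2)) auto
    then show "psd ((1 / \<delta>) *\<^sub>R c - e)" using d by (simp add: scaleR_diff_right)
  qed blast
  have "norm (c - c * q) \<le> \<delta> * (1 + norm q)" by (rule u(3)[OF q(2)])
  also have "\<dots> \<le> \<delta> * (1 + 1)" using projection_norm_le[OF q(1)] d by (intro mult_left_mono) auto
  finally show ?thesis using q(1) that by simp
qed

text \<open>A cluster point q of s n = r 0 - r n fixes every jump x m = r m - r (m + 1), because s n
  does for n > m. But q is within 1 of some t in the span of the s n, and such a t kills all late
  jumps. So norm (x N) \<le> norm (q - t) * norm (x N) makes a late jump vanish.\<close>

lemma projection_descending_chain_stops:
  fixes r :: "nat \<Rightarrow> 'a::cstar_algebra"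
  assumes W: "weakly_compact_intervals TYPE('a)"
    and r: "\<And>n. projection (r n)" "\<And>n. r n * r (Suc n) = r (Suc n)"
  shows "\<exists>n. r (Suc n) = r n"
proof -
  have mono: "r m * r n = r n" if "m \<le> n" for m n
    using that
  proof (induction n rule: dec_induct)
    case base
    then show ?case using r(1) by (simp add: projection_def)
  next
    case (step n)
    have "r m * r (Suc n) = r m * r n * r (Suc n)" by (simp add: r(2) mult.assoc)
    then show ?case by (simp add: step r(2))
  qed
  have mono': "r n * r m = r n" if "m \<le> n" for m n
    by (rule projection_diff(3)[OF r(1) r(1) mono[OF that]])
  define s where "s n = r 0 - r n" for n
  have s: "psd (s n)" "psd (r 0 - s n)" for n
    using projection_psd[OF projection_diff(1)[OF r(1) r(1) mono, of 0 n]] projection_psd[OF r(1)]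
    by (simp_all add: s_def)
  obtain q where q: "q \<in> closure (span (range s))" "\<And>a b. (\<lambda>n. s n * a) \<longlonglongrightarrow> b \<Longrightarrow> q * a = b"
    by (rule weak_limit[OF W projection_psd[OF r(1)[of 0]], of s]) (use s in blast)+
  define x where "x m = r m - r (Suc m)" for m
  have r0x: "r 0 * x m = x m" for m by (simp add: x_def right_diff_distrib mono)
  have "s n * x m = x m" if "n \<ge> Suc m" for m n
  proof -
    have "r n * x m = 0" using that by (simp add: x_def right_diff_distrib mono')
    then show ?thesis by (simp add: s_def left_diff_distrib r0x)
  qed
  then have "(\<lambda>n. s n * x m) \<longlonglongrightarrow> x m" for m
    by (intro tendsto_eventually eventually_sequentiallyI[of "Suc m"])
  then have qx: "q * x m = x m" for m by (rule q(2))
  obtain t where t: "t \<in> span (range s)" "dist t q < 1"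
    using q(1) unfolding closure_approachable by (meson zero_less_one)
  \<comment> \<open>Eventual annihilation of the jumps is preserved by finite linear combinations,
    and s k annihilates x m from m = k on.\<close>
  have "span (range s) \<subseteq> {t. \<exists>N. \<forall>m\<ge>N. t * x m = 0}"
  proof (rule span_minimal)
    have "s k * x m = 0" if "m \<ge> k" for k m
      using that by (simp add: s_def left_diff_distrib r0x) (simp add: x_def right_diff_distrib mono)
    then show "range s \<subseteq> {t. \<exists>N. \<forall>m\<ge>N. t * x m = 0}" by blast
    show "subspace {t. \<exists>N. \<forall>m\<ge>N. t * x m = 0}"
    proof (rule subspaceI)
      fix y z assume "y \<in> {t. \<exists>N. \<forall>m\<ge>N. t * x m = 0}" "z \<in> {t. \<exists>N. \<forall>m\<ge>N. t * x m = 0}"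
      then obtain M N where "\<forall>m\<ge>M. y * x m = 0" "\<forall>m\<ge>N. z * x m = 0" by blast
      then show "y + z \<in> {t. \<exists>N. \<forall>m\<ge>N. t * x m = 0}"
        by (intro CollectI exI[of _ "max M N"]) (simp add: distrib_right)
    qed auto
  qed
  with t(1) obtain N where "t * x N = 0" by blast
  then have "x N = (q - t) * x N" by (simp add: left_diff_distrib qx)
  then have "norm (x N) \<le> norm (q - t) * norm (x N)" by (metis norm_mult_ineq)
  moreover have "norm (q - t) < 1" using t(2) by (simp add: dist_norm norm_minus_commute)
  then have "norm (q - t) * norm (x N) < 1 * norm (x N)" if "x N \<noteq> 0"
    using that by (intro mult_strict_right_mono) auto
  ultimately have "x N = 0" by (metis mult_1 not_le)
  then show ?thesis by (intro exI[of _ N]) (simp add: x_def)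
qed

section \<open>Well-foundedness and minimal projections\<close>

definition projection_less :: "('a::cstar_algebra \<times> 'a) set"
  where "projection_less = {(q, p). projection q \<and> projection p \<and> p * q = q \<and> q \<noteq> p}"

lemma wf_projection_less:
  assumes "weakly_compact_intervals TYPE('a::cstar_algebra)"
  shows "wf (projection_less :: ('a \<times> 'a) set)"
  unfolding wf_iff_no_infinite_down_chain
proof
  assume "\<exists>f :: nat \<Rightarrow> 'a. \<forall>i. (f (Suc i), f i) \<in> projection_less"
  then obtain f :: "nat \<Rightarrow> 'a" where f: "\<And>i. (f (Suc i), f i) \<in> projection_less" by blast
  have "\<exists>n. f (Suc n) = f n"
    by (rule projection_descending_chain_stops[OF assms]) (use f in \<open>auto simp: projection_less_def\<close>)
  with f show False unfolding projection_less_def by blast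
qed

text \<open>Minimality is encoded as one-dimensionality of the corner p A p, the property used for
  rank one; its link with smaller projections is \<open>split_projection\<close>.\<close>

definition minimal_projection :: "'a::cstar_algebra \<Rightarrow> bool"
  where "minimal_projection p \<longleftrightarrow> projection p \<and> p \<noteq> 0 \<and> (\<forall>b. \<exists>z. p * b * p = z *\<^sub>C p)"

text \<open>A corner that is not one-dimensional contains a self-adjoint h that is no real multiple
  of p. For a suitable r both orthogonal parts of h - r p are nonzero; the support projection of the
  positive part lies below p and kills the negative part.\<close>

lemma split_projection:
  fixes p :: "'a::cstar_algebra"
  assumes W: "weakly_compact_intervals TYPE('a)" and p: "projection p" "p \<noteq> 0" "\<not> minimal_projection p"
  obtains q where "projection q" "p * q = q" "q \<noteq> 0" "q \<noteq> p"
proof -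
  have pp: "star p = p" "p * p = p" using p(1) by (simp_all add: projection_def)
  obtain b where b: "\<And>z. p * b * p \<noteq> z *\<^sub>C p" using p unfolding minimal_projection_def by blast
  obtain h where h: "star h = h" "p * h = h" "h * p = h" "\<And>r. h \<noteq> r *\<^sub>R p"
  proof -
    obtain x y where xy: "star x = x" "star y = y" "b = x + \<i> *\<^sub>C y" by (rule real_imag_parts)
    have "\<not> (\<exists>r s. p * x * p = r *\<^sub>R p \<and> p * y * p = s *\<^sub>R p)"
    proof
      assume "\<exists>r s. p * x * p = r *\<^sub>R p \<and> p * y * p = s *\<^sub>R p"
      then obtain r s where "p * x * p = r *\<^sub>R p" "p * y * p = s *\<^sub>R p" by blast
      then have "p * b * p = (complex_of_real r + \<i> * complex_of_real s) *\<^sub>C p"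
        by (simp only: xy distrib_left distrib_right mult_scaleC_left mult_scaleC_right scaleC_add_left
            scaleR_scaleC[of r p] scaleR_scaleC[of s p] scaleC_scaleC)
      with b show False by blast
    qed
    then obtain z where z: "star z = z" "\<And>r. p * z * p \<noteq> r *\<^sub>R p" using xy by blast
    have "star (p * z * p) = p * z * p" by (simp add: star_mult pp z mult.assoc)
    moreover have "p * (p * z * p) = p * z * p" "p * z * p * p = p * z * p"
      by (simp_all add: pp flip: mult.assoc) (simp add: mult.assoc pp)
    ultimately show ?thesis using z(2) that by blast
  qed
  \<comment> \<open>These are the r with r p below, respectively above, h. Both sets are closed and
    nonempty, and disjoint because h is no multiple of p, so by connectedness of the reals some r
    lies in neither.\<close>
  define D D' where "D = {r. psd (h - r *\<^sub>R p)}" and "D' = {r. psd (r *\<^sub>R p - h)}"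
  have "closed ((\<lambda>r. h - r *\<^sub>R p) -` {x. psd x})" "closed ((\<lambda>r. r *\<^sub>R p - h) -` {x. psd x})"
    by (intro continuous_closed_vimage closed_psd continuous_intros)+
  then have "closed D" "closed D'" by (simp_all add: D_def D'_def vimage_def)
  moreover have "norm h \<in> D'"
  proof -
    have "psd (of_real (norm (emb h)) - emb h)" using h(1) by (intro psd_norm_minus) (simp flip: emb_star)
    then have "psd (star (emb p) * (of_real (norm (emb h)) - emb h) * emb p)" by (rule psd_conj)
    also have "star (emb p) * (of_real (norm (emb h)) - emb h) * emb p = emb (norm h *\<^sub>R p - h)"
      by (simp add: emb_simps of_real_def left_diff_distrib right_diff_distrib)
         (simp add: pp h(2,3) flip: emb_mult emb_star)
    finally show ?thesis by (simp add: D'_def)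
  qed
  moreover have "- norm h \<in> D"
  proof -
    have "psd (of_real (norm (emb (- h))) - emb (- h))" using h(1)
      by (intro psd_norm_minus) (simp add: star_minus flip: emb_star)
    then have "psd (star (emb p) * (of_real (norm (emb (- h))) - emb (- h)) * emb p)" by (rule psd_conj)
    also have "star (emb p) * (of_real (norm (emb (- h))) - emb (- h)) * emb p = emb (h - (- norm h) *\<^sub>R p)"
      by (simp add: emb_simps of_real_def distrib_left distrib_right add.commute)
         (simp add: pp h(2,3) flip: emb_mult emb_star)
    finally show ?thesis by (simp add: D_def)
  qed
  moreover have "D \<inter> D' = {}"
  proof -
    have False if "psd (h - r *\<^sub>R p)" "psd (r *\<^sub>R p - h)" for r
      using psd_antisym[of "h - r *\<^sub>R p"] that h(4)[of r] by simp
    then show ?thesis by (auto simp: D_def D'_def)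
  qed
  ultimately have "\<not> UNIV \<subseteq> D \<union> D'"
    using connected_UNIV[where 'a = real] unfolding connected_closed by blast
  then obtain r where r: "\<not> psd (h - r *\<^sub>R p)" "\<not> psd (r *\<^sub>R p - h)"
    by (auto simp: D_def D'_def)
  define x where "x = h - r *\<^sub>R p"
  have "star x = x" by (simp add: x_def star_diff star_scaleR h(1) pp)
  then obtain u v where uv: "psd u" "psd v" "x = u - v" "u * v = 0" "v * u = 0"
    "\<And>p. x * p = x \<Longrightarrow> u * p = u" "\<And>p. x * p = x \<Longrightarrow> v * p = v"
    by (rule orthogonal_decomposition) blast
  have "x * p = x" by (simp add: x_def left_diff_distrib h pp)
  then have up: "u * p = u" and "v * p = v" using uv(6,7) by blast+
  have pu: "p * u = u" using arg_cong[OF up, of star] by (simp add: star_mult pp psd_self_adjoint[OF uv(1)])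
  have pv: "p * v = v" using arg_cong[OF \<open>v * p = v\<close>, of star]
    by (simp add: star_mult pp psd_self_adjoint[OF uv(2)])
  have "v = r *\<^sub>R p - h" if "u = 0" using uv(3) that by (simp add: x_def algebra_simps)
  then have "u \<noteq> 0" using r(2) uv(2) by auto
  have "v \<noteq> 0" using r(1) uv(1,3) by (auto simp: x_def)
  obtain q where q: "projection q" "q * u = u" "u * q = u" "\<And>v. u * v = 0 \<Longrightarrow> q * v = 0"
    "\<And>p. p * u = u \<Longrightarrow> p * q = q"
  \<comment> \<open>Here p itself bounds the resolvents: p u = u gives p e = e, and compressing 1 -
    e by p yields p - e \<ge> 0.\<close>
  proof (rule support_projection[OF W projection_psd[OF p(1)] uv(1)])
    fix e assume e: "psd e" "psd (1 - emb e)" "\<forall>q. q * u = u \<longrightarrow> q * e = e"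
    have pe: "p * e = e" using e(3) pu by blast
    have "psd (star (emb p) * (1 - emb e) * emb p)" by (rule psd_conj[OF e(2)])
    also have "star (emb p) * (1 - emb e) * emb p = emb (p - e * p)"
      by (simp add: left_diff_distrib right_diff_distrib emb_diff) (simp add: pp pe flip: emb_mult emb_star)
    finally have "psd (p - e * p)" by simp
    moreover have "e * p = e" using arg_cong[OF pe, of star] by (simp add: star_mult pp psd_self_adjoint[OF e(1)])
    ultimately show "psd (p - e)" by simp
  qed blast
  show ?thesis
  proof (rule that[OF q(1) q(5)[OF pu]])
    show "q \<noteq> 0" using q(2) \<open>u \<noteq> 0\<close> by auto
    show "q \<noteq> p" using q(4)[OF uv(4)] pv \<open>v \<noteq> 0\<close> by auto
  qed
qed

lemma ex_minimal_projection_below: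
  fixes p :: "'a::cstar_algebra"
  assumes W: "weakly_compact_intervals TYPE('a)"
  shows "projection p \<Longrightarrow> p \<noteq> 0 \<Longrightarrow> \<exists>m. minimal_projection m \<and> p * m = m"
proof (induction p rule: wf_induct_rule[OF wf_projection_less[OF W]])
  case (1 p)
  show ?case
  proof (cases "minimal_projection p")
    case True
    then show ?thesis using 1(2) by (auto simp: projection_def)
  next
    case False
    obtain q where q: "projection q" "p * q = q" "q \<noteq> 0" "q \<noteq> p"
      using split_projection[OF W 1(2,3) False] .
    have "(q, p) \<in> projection_less" using q 1(2) by (simp add: projection_less_def)
    then obtain m where m: "minimal_projection m" "q * m = m" using 1(1) q by blast
    have "p * m = p * q * m" by (simp add: mult.assoc m(2))
    then have "p * m = m" by (simp add: q(2) m(2))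
    with m(1) show ?thesis by blast
  qed
qed

section \<open>Compactness of two-sided multiplication by projections\<close>

definition corner_compact :: "'a::cstar_algebra \<Rightarrow> 'a \<Rightarrow> bool"
  where "corner_compact p q \<longleftrightarrow> (\<forall>B. bounded B \<longrightarrow> relatively_compact ((\<lambda>b. p * b * q) ` B))"

lemma corner_compact_zero: "corner_compact 0 q" "corner_compact p 0"
  by (auto simp: corner_compact_def intro!: relatively_compact_if_subset_compact[of "{0}"])

lemma relatively_compact_add:
  fixes f g :: "'b \<Rightarrow> 'a::real_normed_vector"
  assumes "relatively_compact (f ` B)" "relatively_compact (g ` B)"
  shows "relatively_compact ((\<lambda>b. f b + g b) ` B)"
proof (rule relatively_compact_if_subset_compact)
  show "compact {x + y | x y. x \<in> closure (f ` B) \<and> y \<in> closure (g ` B)}"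
    using assms by (intro compact_sums) (auto simp: relatively_compact_def)
  show "(\<lambda>b. f b + g b) ` B \<subseteq> {x + y | x y. x \<in> closure (f ` B) \<and> y \<in> closure (g ` B)}"
  proof (rule image_subsetI)
    fix b assume "b \<in> B"
    then have "f b \<in> closure (f ` B)" "g b \<in> closure (g ` B)"
      by (simp_all add: closure_subset[THEN subsetD])
    then show "f b + g b \<in> {x + y | x y. x \<in> closure (f ` B) \<and> y \<in> closure (g ` B)}" by blast
  qed
qed

lemma corner_compact_add:
  "corner_compact p q \<Longrightarrow> corner_compact p' q \<Longrightarrow> corner_compact (p + p') q"
  "corner_compact p q \<Longrightarrow> corner_compact p q' \<Longrightarrow> corner_compact p (q + q')"
  by (simp_all add: corner_compact_def distrib_left distrib_right relatively_compact_add)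

text \<open>If x = m a n is nonzero, then \<open>star x * x\<close> is a nonzero multiple of n,
  while \<open>m * b * n * star x\<close> lies in the corner of m and is a multiple of m.
  Multiplying by x on the right shows that m b n is a multiple of x, so bounded sets map into a
  compact disc of multiples of x.\<close>

lemma corner_compact_minimal:
  fixes m n :: "'a::cstar_algebra"
  assumes m: "minimal_projection m" and n: "minimal_projection n"
  shows "corner_compact m n"
proof (cases "\<exists>b. m * b * n \<noteq> 0")
  case False
  then show ?thesis
    by (auto simp: corner_compact_def intro!: relatively_compact_if_subset_compact[of "{0}"])
next
  case True
  then obtain a where a: "m * a * n \<noteq> 0" by blast
  have mm: "star m = m" "m * m = m" "norm m \<le> 1" and nn: "star n = n" "n * n = n" "norm n \<le> 1"
    using m n projection_norm_le by (auto simp: minimal_projection_def projection_def)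
  define x where "x = m * a * n"
  obtain z where "n * (star a * m * a) * n = z *\<^sub>C n" using n by (auto simp: minimal_projection_def)
  moreover have "star x * x = n * (star a * (m * m) * a) * n"
    by (simp only: x_def star_mult mm(1) nn(1) mult.assoc)
  ultimately have z: "star x * x = z *\<^sub>C n" by (simp only: mm(2))
  have "z \<noteq> 0" using z a star_mult_self_eq_0[of x] by (auto simp: x_def)
  have multiple: "\<exists>t. m * b * n = t *\<^sub>C x" for b
  proof -
    obtain w where "m * (b * n * star a) * m = w *\<^sub>C m" using m by (auto simp: minimal_projection_def)
    moreover have "m * b * n * star x = m * (b * (n * n) * star a) * m"
      by (simp only: x_def star_mult mm(1) nn(1) mult.assoc)
    ultimately have w: "m * b * n * star x = w *\<^sub>C m" by (simp only: nn(2))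
    have "m * b * n * (star x * x) = m * b * n * star x * x" by (simp add: mult.assoc)
    then have "z *\<^sub>C (m * b * n * n) = w *\<^sub>C (m * x)"
      by (simp only: z w mult_scaleC_left mult_scaleC_right)
    moreover have "m * b * n * n = m * b * n" by (simp add: mult.assoc nn)
    moreover have "m * x = x" by (simp add: x_def mm flip: mult.assoc)
    ultimately have "z *\<^sub>C (m * b * n) = w *\<^sub>C x" by simp
    then have "inverse z *\<^sub>C z *\<^sub>C (m * b * n) = inverse z *\<^sub>C w *\<^sub>C x" by simp
    then show ?thesis using \<open>z \<noteq> 0\<close> by (auto simp: scaleC_scaleC)
  qed
  have x: "norm x > 0" using a by (simp add: x_def)
  show ?thesis unfolding corner_compact_def
  proof (intro allI impI)
    fix B :: "'a set" assume "bounded B"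
    then obtain R where R: "R > 0" "\<And>b. b \<in> B \<Longrightarrow> norm b \<le> R" unfolding bounded_pos by blast
    show "relatively_compact ((\<lambda>b. m * b * n) ` B)"
    proof (rule relatively_compact_if_subset_compact)
      have "bounded_linear (\<lambda>t. t *\<^sub>C x)"
        by (rule bounded_linear_intro[where K = "norm x"])
          (auto simp: scaleC_add_left scaleR_scaleC_left norm_scaleC)
      then show "compact ((\<lambda>t. t *\<^sub>C x) ` cball 0 (R / norm x))"
        by (intro compact_continuous_image linear_continuous_on) auto
      show "(\<lambda>b. m * b * n) ` B \<subseteq> (\<lambda>t. t *\<^sub>C x) ` cball 0 (R / norm x)"
      proof
        fix y assume "y \<in> (\<lambda>b. m * b * n) ` B"
        then obtain b where b: "b \<in> B" "y = m * b * n" by blast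
        obtain t where t: "m * b * n = t *\<^sub>C x" using multiple by blast
        have "norm (m * b * n) \<le> norm m * norm b * norm n"
          by (rule order_trans[OF norm_mult_ineq mult_right_mono[OF norm_mult_ineq norm_ge_zero]])
        also have "\<dots> \<le> 1 * R * 1" using mm nn R(1) R(2)[OF b(1)] by (intro mult_mono) auto
        finally have "cmod t * norm x \<le> R" by (simp add: t norm_scaleC)
        then have "t \<in> cball 0 (R / norm x)" using x by (simp add: field_simps)
        then show "y \<in> (\<lambda>t. t *\<^sub>C x) ` cball 0 (R / norm x)" using b(2) t by blast
      qed
    qed
  qed
qed

text \<open>Subtracting a minimal projection below p leaves a strictly smaller projection;
  well-foundedness ends the process after finitely many subtractions.\<close>

lemma projection_induct_minimal:
  fixes p :: "'a::cstar_algebra"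
  assumes W: "weakly_compact_intervals TYPE('a)" and p: "projection p"
    and zero: "P 0" and step: "\<And>m q. minimal_projection m \<Longrightarrow> P q \<Longrightarrow> P (m + q)"
  shows "P p"
  using p
proof (induction p rule: wf_induct_rule[OF wf_projection_less[OF W]])
  case (1 p)
  show ?case
  proof (cases "p = 0")
    case False
    then obtain m where m: "minimal_projection m" "p * m = m"
      using ex_minimal_projection_below[OF W 1(2)] by blast
    then have pm: "projection m" "m \<noteq> 0" by (auto simp: minimal_projection_def)
    have "projection (p - m)" "(p - m, p) \<in> projection_less"
      using projection_diff[OF 1(2) pm(1) m(2)] 1(2) pm(2) by (auto simp: projection_less_def)
    then have "P (m + (p - m))" using 1(1) m(1) step by blast
    then show ?thesis by simp
  qed (use zero in simp)
qed

text \<open>Additivity in each slot separately: the left projection is decomposed against a minimal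
  right one, then the right projection.\<close>

lemma corner_compact_projections:
  fixes p q :: "'a::cstar_algebra"
  assumes W: "weakly_compact_intervals TYPE('a)" and p: "projection p" and q: "projection q"
  shows "corner_compact p q"
proof -
  have pm: "corner_compact p m" if "minimal_projection m" for m
  proof (rule projection_induct_minimal[OF W p, where P = "\<lambda>p. corner_compact p m"])
    show "corner_compact (n + p) m" if "minimal_projection n" "corner_compact p m" for n p
      by (rule corner_compact_add(1)[OF corner_compact_minimal])
        (use that \<open>minimal_projection m\<close> in auto)
  qed (rule corner_compact_zero)
  show ?thesis
  proof (rule projection_induct_minimal[OF W q, where P = "corner_compact p"])
    show "corner_compact p (n + q)" if "minimal_projection n" "corner_compact p q" for n q
      by (rule corner_compact_add(2)[OF pm]) (use that in auto)
  qed (rule corner_compact_zero)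
qed

text \<open>c dominates both C*-squares of a, so a single q works on both sides: (norm (b - b q))^2
  is the norm of \<open>star b * b\<close> compressed by 1 - q, which is at most that of c
  compressed in the same way.\<close>

lemma approximate_by_corner:
  fixes a :: "'a::cstar_algebra"
  assumes W: "weakly_compact_intervals TYPE('a)" and d: "\<delta> > 0"
  obtains q where "projection q" "norm (a - a * q) \<le> \<delta>" "norm (a - q * a) \<le> \<delta>"
proof -
  define c where "c = star a * a + star (star a) * star a"
  have c: "psd c" unfolding c_def by (intro psd_add psd_star_mult)
  \<comment> \<open>One factor 2 comes with the spectral projection, another from norm (1 - q) \<le>
    2; dividing by 4 leaves \<delta>^2.\<close>
  obtain q where q: "projection q" "norm (c - c * q) \<le> 2 * (\<delta>\<^sup>2 / 4)"
    using spectral_projection[OF W c, of "\<delta>\<^sup>2 / 4"] d by (auto simp: zero_less_power)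
  have sq: "star q = q" using q(1) by (simp add: projection_def)
  define E where "E = 1 - emb q"
  have sE: "star E = E" by (simp add: E_def star_diff sq flip: emb_star)
  have nE: "norm E \<le> 2" unfolding E_def by (rule norm_one_minus_emb_le[OF projection_norm_le[OF q(1)]])
  have cE: "emb c * E = emb (c - c * q)" by (simp add: E_def emb_simps algebra_simps)
  have "norm (star E * (emb c * E)) \<le> norm E * norm (emb c * E)" by (metis norm_mult_ineq sE)
  also have "\<dots> \<le> 2 * (2 * (\<delta>\<^sup>2 / 4))" unfolding cE using nE q(2) by (intro mult_mono) auto
  finally have EcE: "norm (star E * (emb c * E)) \<le> \<delta>\<^sup>2" by simp
  have le: "norm (b - b * q) \<le> \<delta>" if b: "psd (c - star b * b)" for b
  proof (rule power2_le_imp_le)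
    have eq: "emb (b - b * q) = emb b * E" by (simp add: E_def emb_simps algebra_simps)
    have "(norm (b - b * q))\<^sup>2 = norm (star (emb b * E) * (emb b * E))"
      by (simp add: cstar_identity flip: eq)
    also have "star (emb b * E) * (emb b * E) = star E * emb (star b * b) * E"
      by (simp add: star_mult emb_simps mult.assoc)
    also have "norm \<dots> \<le> norm (star E * emb c * E)"
    proof (rule psd_norm_mono_unital)
      show "psd (star E * emb (star b * b) * E)" by (intro psd_conj) (simp add: psd_star_mult)
      have "psd (star E * emb (c - star b * b) * E)" using b by (intro psd_conj) simp
      then show "psd (star E * emb c * E - star E * emb (star b * b) * E)" by (simp add: emb_diff algebra_simps)
    qed
    finally show "(norm (b - b * q))\<^sup>2 \<le> \<delta>\<^sup>2" using EcE by (simp add: mult.assoc)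
  qed (use d in simp)
  have "norm (a - a * q) \<le> \<delta>" by (rule le) (simp add: c_def psd_star_mult del: star_star)
  moreover have "norm (star a - star a * q) \<le> \<delta>" by (rule le) (simp add: c_def psd_star_mult)
  then have "norm (star (a - q * a)) \<le> \<delta>" by (simp add: star_diff star_mult sq)
  then have "norm (a - q * a) \<le> \<delta>" by (simp add: norm_star)
  ultimately show ?thesis using q(1) that by blast
qed

lemma bounded_linear_two_sided_mult: "bounded_linear (\<lambda>b. a * b * (c :: 'a::real_normed_algebra))"
  by (rule bounded_linear_compose[OF bounded_linear_mult_left bounded_linear_mult_right])

lemma weakly_compact_intervals_imp_compact_algebra:
  assumes W: "weakly_compact_intervals TYPE('a::cstar_algebra)"
  shows "compact_algebra TYPE('a)"
  unfolding compact_algebra_def multiplication_compact_def compact_operator_def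
proof (intro allI conjI impI)
  fix a :: 'a
  show "bounded_linear (\<lambda>b. a * b * a)" by (rule bounded_linear_two_sided_mult)
  fix B :: "'a set" assume "bounded B"
  then obtain R where R: "R > 0" "\<And>b. b \<in> B \<Longrightarrow> norm b \<le> R" unfolding bounded_pos by blast
  show "relatively_compact ((\<lambda>b. a * b * a) ` B)"
  proof (rule relatively_compact_approx)
    fix \<epsilon> :: real assume \<epsilon>: "\<epsilon> > 0"
    \<comment> \<open>Twice R * norm a bounds the combined weight of the two error terms; the
      summand 1 keeps K positive for a = 0.\<close>
    define K where "K = 2 * R * (norm a + 1)"
    have K: "K > 0" using R by (simp add: K_def add_nonneg_pos)
    obtain q where q: "projection q" "norm (a - a * q) \<le> \<epsilon> / (2 * K)" "norm (a - q * a) \<le> \<epsilon> / (2 * K)"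
      using approximate_by_corner[OF W, of "\<epsilon> / (2 * K)" a] \<epsilon> K by auto
    define T where "T = (\<lambda>y. a * y * a) ` ((\<lambda>b. q * b * q) ` B)"
    have "relatively_compact ((\<lambda>b. q * b * q) ` B)"
      using corner_compact_projections[OF W q(1) q(1)] \<open>bounded B\<close> unfolding corner_compact_def by blast
    then have "relatively_compact T" unfolding T_def
      by (rule relatively_compact_image[OF _ linear_continuous_on[OF bounded_linear_two_sided_mult]])
    moreover have "dist (a * b * a) (a * (q * b * q) * a) < \<epsilon>" if b: "b \<in> B" for b
    proof -
      have t3: "norm (x * y * z) \<le> norm x * norm y * norm z" for x y z :: 'a
        by (rule order_trans[OF norm_mult_ineq mult_right_mono[OF norm_mult_ineq norm_ge_zero]])
      have aq: "norm (a * q) \<le> norm a"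
        using order_trans[OF norm_mult_ineq mult_left_le[OF projection_norm_le[OF q(1)] norm_ge_zero]] .
      \<comment> \<open>The error is telescoped so that each term has exactly one small factor, the
        left or the right defect of q.\<close>
      have "a * b * a - a * (q * b * q) * a = (a - a * q) * b * a + (a * q) * b * (a - q * a)"
        by (simp add: algebra_simps)
      then have "dist (a * b * a) (a * (q * b * q) * a)
          \<le> norm (a - a * q) * norm b * norm a + norm (a * q) * norm b * norm (a - q * a)"
        unfolding dist_norm using norm_triangle_mono[OF t3 t3] by metis
      also have "\<dots> \<le> \<epsilon> / (2 * K) * R * norm a + norm a * R * (\<epsilon> / (2 * K))"
        using q(2,3) R(1) R(2)[OF b] aq \<epsilon> K by (intro add_mono mult_mono) auto
      also have "\<dots> = \<epsilon> / (2 * K) * (2 * R * norm a)" by (simp add: algebra_simps)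
      also have "\<dots> \<le> \<epsilon> / (2 * K) * K"
        unfolding K_def using R \<epsilon> K by (intro mult_left_mono) (auto simp: K_def)
      also have "\<dots> < \<epsilon>" using K \<epsilon> by simp
      finally show ?thesis .
    qed
    ultimately show "\<exists>T. relatively_compact T \<and> (\<forall>x\<in>(\<lambda>b. a * b * a) ` B. \<exists>y\<in>T. dist x y < \<epsilon>)"
      by (intro exI[of _ T]) (auto simp: T_def)
  qed
qed

theorem proposition1p3p3:
  defines "S1 \<equiv> compact_algebra TYPE('a::cstar_algebra)"
    and "S2 \<equiv> \<forall>c\<in>(positive_cone :: 'a set). compact (order_interval_from_0 c)"
    and "S3 \<equiv> \<forall>c\<in>(positive_cone :: 'a set). compactin weak_topology (order_interval_from_0 c)"
    and "S4 \<equiv> \<forall>M\<subseteq>(positive_cone :: 'a set). relatively_compact M \<longrightarrow> relatively_compact (PSol M)"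
  shows "(S1 \<longleftrightarrow> S2) \<and> (S2 \<longleftrightarrow> S3) \<and> (S3 \<longleftrightarrow> S4)"
proof -
  have "S1 \<Longrightarrow> S4"
    unfolding S1_def S4_def by (blast intro: compact_algebra_imp_relatively_compact_PSol)
  moreover have "S4 \<Longrightarrow> S2"
    unfolding S4_def S2_def by (blast intro: relatively_compact_PSol_imp_compact_interval)
  moreover have "S2 \<Longrightarrow> S3"
    unfolding S2_def S3_def by (blast intro: compact_imp_compactin_weak)
  moreover have "S3 \<Longrightarrow> S1"
    unfolding S3_def S1_def
    by (intro weakly_compact_intervals_imp_compact_algebra)
      (simp add: weakly_compact_intervals_def positive_cone_iff)
  ultimately show ?thesis by blast
qed

end
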